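(* Let $\{f_1,\dots,f_g\}$ be a basis of $S_2(\Gamma)$ and fix $z_0\in\mathfrak H$. Then the constant function $1$ together with the functions $z\mapsto\int_{z_0}^z f_i(w)\,dw$, $1\le i\le g$, form a basis of $M_0^2(\Gamma)$; in particular $\dim M_0^2(\Gamma)=g+1$.
   Context: Let $\Gamma\subset PSL_2(\mathbb{R})$ be a Fuchsian group of the first kind acting on $\mathfrak{H}=\{z=x+iy:y>0\}$ with $\Gamma\backslash\mathfrak{H}$ non-compact of genus $g$. For each cusp $\mathfrak a$ (from a fixed set of representatives) fix $\sigma_{\mathfrak a}\in PSL_2(\mathbb R)$ with $\sigma_{\mathfrak a}\infty=\mathfrak a$ and $\sigma_{\mathfrak a}^{-1}\Gamma_{\mathfrak a}\sigma_{\mathfrak a}=\{\pm\begin{pmatrix}1&n\\0&1\end{pmatrix}:n\in\mathbb Z\}$. For $\gamma=\pm\begin{pmatrix}a&b\\c&d\end{pmatrix}$: $(f|_k\gamma)(z)=f(\gamma z)(cz+d)^{-k}$, extended linearly. $S_2(\Gamma)$: weight 2 holomorphic cusp forms. $M_0(\Gamma)$: holomorphic $\Gamma$-invariant $f$ with $f(\sigma_{\mathfrak a}z)\ll y^c$ as $y\to\infty$ uniformly in $x$ at every cusp. $M_0^2(\Gamma)$: holomorphic $f$ with $f|_0(\gamma-1)\in M_0(\Gamma)$ for all $\gamma\in\Gamma$, $f|_0(\pi-1)=0$ for every parabolic $\pi\in\Gamma$, and $f(\sigma_{\mathfrak a}z)\ll y^c$ for some constant $c$ as $y\to\infty$ uniformly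 in $x$ at every cusp. *)

theory Defs
  imports
    "HOL-Complex_Analysis.Complex_Analysis"
    "HOL-Library.Function_Algebras"
    "HOL-Algebra.Coset"
begin

no_notation fps_nth (infixl "$" 75)

subsection \<open>The group $PSL_2(R)$\<close>

definition SL2R :: "(real^2^2) monoid" where
  "SL2R = \<lparr>carrier = {A. det A = 1}, mult = (**), one = mat 1\<rparr>"

definition PSL2R :: "(real^2^2) set monoid" where
  "PSL2R = SL2R Mod {mat 1, - mat 1}"

definition psl :: "real^2^2 \<Rightarrow> (real^2^2) set" where
  "psl A = {mat 1, - mat 1} #>\<^bsub>SL2R\<^esub> A"

text \<open>A representing matrix of a class $\pm A$; everything below that is built from it is
  independent of the choice of sign.\<close>

definition psl_rep :: "(real^2^2) set \<Rightarrow> real^2^2" where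
  "psl_rep \<gamma> = (SOME A. A \<in> \<gamma>)"

definition quotient_topology :: "'a topology \<Rightarrow> ('a \<Rightarrow> 'b) \<Rightarrow> 'b topology" where
  "quotient_topology X q =
     topology (\<lambda>U. U \<subseteq> q ` topspace X \<and> openin X {x \<in> topspace X. q x \<in> U})"

definition PSL2R_topology :: "(real^2^2) set topology" where
  "PSL2R_topology = quotient_topology (top_of_set (carrier SL2R)) psl"

definition parabolic :: "(real^2^2) set \<Rightarrow> bool" where
  "parabolic \<gamma> \<longleftrightarrow> \<gamma> \<in> carrier PSL2R \<and> \<gamma> \<noteq> \<one>\<^bsub>PSL2R\<^esub> \<and> \<bar>trace (psl_rep \<gamma>)\<bar> = 2"

subsection \<open>Action on the upper half plane and on the Riemann sphere\<close>

definition uhp :: "complex set" where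
  "uhp = {z. Im z > 0}"

definition aut_factor :: "(real^2^2) set \<Rightarrow> complex \<Rightarrow> complex" where
  "aut_factor \<gamma> z = complex_of_real (psl_rep \<gamma> $ 2 $ 1) * z + complex_of_real (psl_rep \<gamma> $ 2 $ 2)"

definition mob :: "(real^2^2) set \<Rightarrow> complex \<Rightarrow> complex" where
  "mob \<gamma> z = (complex_of_real (psl_rep \<gamma> $ 1 $ 1) * z + complex_of_real (psl_rep \<gamma> $ 1 $ 2))
             / aut_factor \<gamma> z"

datatype rsphere = Fin complex | Infty

fun mob_sphere :: "(real^2^2) set \<Rightarrow> rsphere \<Rightarrow> rsphere" where
  "mob_sphere \<gamma> (Fin z) = (if aut_factor \<gamma> z = 0 then Infty else Fin (mob \<gamma> z))"
| "mob_sphere \<gamma> Infty =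
     (if psl_rep \<gamma> $ 2 $ 1 = 0 then Infty
      else Fin (complex_of_real (psl_rep \<gamma> $ 1 $ 1 / psl_rep \<gamma> $ 2 $ 1)))"

definition orbit_space ::
    "((real^2^2) set \<Rightarrow> 'a \<Rightarrow> 'a) \<Rightarrow> (real^2^2) set set \<Rightarrow> 'a topology \<Rightarrow> 'a set topology" where
  "orbit_space act \<Gamma> X = quotient_topology X (\<lambda>x. (\<lambda>\<gamma>. act \<gamma> x) ` \<Gamma>)"

subsection \<open>Cusps and Fuchsian groups of the first kind\<close>

definition boundary_circle :: "rsphere set" where
  "boundary_circle = insert Infty (range (\<lambda>r. Fin (complex_of_real r)))"

definition cusps :: "(real^2^2) set set \<Rightarrow> rsphere set" where
  "cusps \<Gamma> = {s \<in> boundary_circle. \<exists>\<pi>\<in>\<Gamma>. parabolic \<pi> \<and> mob_sphere \<pi> s = s}"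

definition extended_uhp :: "(real^2^2) set set \<Rightarrow> rsphere set" where
  "extended_uhp \<Gamma> = Fin ` uhp \<union> cusps \<Gamma>"

text \<open>The usual topology on the upper half plane with the cusps adjoined: it restricts to the
  Euclidean topology on the half plane, and a neighbourhood base of a cusp $s = \rho\infty$ is
  given by $s$ together with the horoballs $\rho\{y > Y\}$ at $s$ (half planes at $\infty$, open discs
  tangent to the real line at a finite cusp).\<close>

definition extended_uhp_topology :: "(real^2^2) set set \<Rightarrow> rsphere topology" where
  "extended_uhp_topology \<Gamma> =
     topology (\<lambda>U. U \<subseteq> extended_uhp \<Gamma> \<and> open {z \<in> uhp. Fin z \<in> U} \<and>
       (\<forall>\<rho>\<in>carrier PSL2R. mob_sphere \<rho> Infty \<in> U \<longrightarrow>
          (\<exists>Y>0. \<forall>z. Im z > Y \<longrightarrow> mob_sphere \<rho> (Fin z) \<in> U)))"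

definition fuchsian :: "(real^2^2) set set \<Rightarrow> bool" where
  "fuchsian \<Gamma> \<longleftrightarrow> subgroup \<Gamma> PSL2R \<and> subtopology PSL2R_topology \<Gamma> = discrete_topology \<Gamma>"

text \<open>First kind in the sense of Shimura: the quotient of the half plane with the cusps adjoined
  is compact (for Fuchsian groups this is the same as finite hyperbolic covolume).\<close>

definition fuchsian_first_kind :: "(real^2^2) set set \<Rightarrow> bool" where
  "fuchsian_first_kind \<Gamma> \<longleftrightarrow>
     fuchsian \<Gamma> \<and> compact_space (orbit_space mob_sphere \<Gamma> (extended_uhp_topology \<Gamma>))"

definition modular_curve :: "(real^2^2) set set \<Rightarrow> complex set topology" where
  "modular_curve \<Gamma> = orbit_space mob \<Gamma> (top_of_set uhp)"

text \<open>The genus of a surface is the largest number of pairwise disjoint simple closed curves whose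
  union does not separate it. For a surface with punctures this is the genus of the surface
  obtained by filling them in, since a loop around a puncture separates.\<close>

definition nonseparating_curves :: "'a topology \<Rightarrow> nat \<Rightarrow> (nat \<Rightarrow> 'a set) \<Rightarrow> bool" where
  "nonseparating_curves X n J \<longleftrightarrow>
     (\<forall>i<n. J i \<subseteq> topspace X \<and>
        subtopology X (J i) homeomorphic_space top_of_set (sphere (0::complex) 1)) \<and>
     disjoint_family_on J {..<n} \<and>
     connected_space (subtopology X (topspace X - (\<Union>i<n. J i)))"

definition has_genus :: "'a topology \<Rightarrow> nat \<Rightarrow> bool" where
  "has_genus X g \<longleftrightarrow>
     (\<exists>J. nonseparating_curves X g J) \<and> (\<forall>n J. nonseparating_curves X n J \<longrightarrow> n \<le> g)"

definition stabilizer_in :: "(real^2^2) set set \<Rightarrow> rsphere \<Rightarrow> (real^2^2) set set" where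
  "stabilizer_in \<Gamma> \<aa> = {\<gamma> \<in> \<Gamma>. mob_sphere \<gamma> \<aa> = \<aa>}"

definition cusp_representatives :: "(real^2^2) set set \<Rightarrow> rsphere set \<Rightarrow> bool" where
  "cusp_representatives \<Gamma> C \<longleftrightarrow>
     C \<subseteq> cusps \<Gamma> \<and> (\<forall>s\<in>cusps \<Gamma>. \<exists>!\<aa>. \<aa> \<in> C \<and> (\<exists>\<gamma>\<in>\<Gamma>. mob_sphere \<gamma> \<aa> = s))"

definition translation_matrix :: "int \<Rightarrow> real^2^2" where
  "translation_matrix n = vector [vector [1, of_int n], vector [0, 1]]"

definition scaling_matrices ::
    "(real^2^2) set set \<Rightarrow> rsphere set \<Rightarrow> (rsphere \<Rightarrow> (real^2^2) set) \<Rightarrow> bool" where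
  "scaling_matrices \<Gamma> C \<sigma> \<longleftrightarrow>
     (\<forall>\<aa>\<in>C. \<sigma> \<aa> \<in> carrier PSL2R \<and> mob_sphere (\<sigma> \<aa>) Infty = \<aa> \<and>
        (\<lambda>\<gamma>. inv\<^bsub>PSL2R\<^esub> (\<sigma> \<aa>) \<otimes>\<^bsub>PSL2R\<^esub> \<gamma> \<otimes>\<^bsub>PSL2R\<^esub> \<sigma> \<aa>) ` stabilizer_in \<Gamma> \<aa>
          = range (\<lambda>n. psl (translation_matrix n)))"

subsection \<open>Spaces of functions on the upper half plane\<close>

text \<open>A function on the upper half plane is represented by its extension by zero to the whole
  complex plane, so that equality of such functions is equality on the half plane.\<close>

definition uhp_functions :: "(complex \<Rightarrow> complex) set" where
  "uhp_functions = {f. \<forall>z. z \<notin> uhp \<longrightarrow> f z = 0}"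

definition on_uhp :: "(complex \<Rightarrow> complex) \<Rightarrow> complex \<Rightarrow> complex" where
  "on_uhp h = (\<lambda>z. if z \<in> uhp then h z else 0)"

text \<open>Independent of the sign of the representing matrix for even weight, the only case used.\<close>

definition slash :: "int \<Rightarrow> (complex \<Rightarrow> complex) \<Rightarrow> (real^2^2) set \<Rightarrow> complex \<Rightarrow> complex" where
  "slash k f \<gamma> = on_uhp (\<lambda>z. f (mob \<gamma> z) * aut_factor \<gamma> z powi (- k))"

definition moderate_growth ::
    "rsphere set \<Rightarrow> (rsphere \<Rightarrow> (real^2^2) set) \<Rightarrow> (complex \<Rightarrow> complex) \<Rightarrow> bool" where
  "moderate_growth C \<sigma> f \<longleftrightarrow>
     (\<forall>\<aa>\<in>C. \<exists>c K Y. Y > 0 \<and> (\<forall>z. Im z \<ge> Y \<longrightarrow> norm (f (mob (\<sigma> \<aa>) z)) \<le> K * Im z powr c))"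

definition S2 ::
    "(real^2^2) set set \<Rightarrow> rsphere set \<Rightarrow> (rsphere \<Rightarrow> (real^2^2) set) \<Rightarrow> (complex \<Rightarrow> complex) set" where
  "S2 \<Gamma> C \<sigma> = {f \<in> uhp_functions. f holomorphic_on uhp \<and> (\<forall>\<gamma>\<in>\<Gamma>. slash 2 f \<gamma> = f) \<and>
     (\<forall>\<aa>\<in>C. \<exists>b :: nat \<Rightarrow> complex. \<forall>z\<in>uhp.
        (\<lambda>n. b n * exp (2 * of_real pi * \<i> * of_nat (Suc n) * z)) sums slash 2 f (\<sigma> \<aa>) z)}"

definition M0 ::
    "(real^2^2) set set \<Rightarrow> rsphere set \<Rightarrow> (rsphere \<Rightarrow> (real^2^2) set) \<Rightarrow> (complex \<Rightarrow> complex) set" where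
  "M0 \<Gamma> C \<sigma> = {f \<in> uhp_functions. f holomorphic_on uhp \<and> (\<forall>\<gamma>\<in>\<Gamma>. slash 0 f \<gamma> = f) \<and>
     moderate_growth C \<sigma> f}"

definition M0_second ::
    "(real^2^2) set set \<Rightarrow> rsphere set \<Rightarrow> (rsphere \<Rightarrow> (real^2^2) set) \<Rightarrow> (complex \<Rightarrow> complex) set" where
  "M0_second \<Gamma> C \<sigma> = {f \<in> uhp_functions. f holomorphic_on uhp \<and>
     (\<forall>\<gamma>\<in>\<Gamma>. slash 0 f \<gamma> - f \<in> M0 \<Gamma> C \<sigma>) \<and>
     (\<forall>\<pi>\<in>\<Gamma>. parabolic \<pi> \<longrightarrow> slash 0 f \<pi> - f = 0) \<and>
     moderate_growth C \<sigma> f}"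

subsection \<open>Complex vector spaces of functions\<close>

definition fscale :: "complex \<Rightarrow> (complex \<Rightarrow> complex) \<Rightarrow> complex \<Rightarrow> complex" where
  "fscale c f = (\<lambda>z. c * f z)"

global_interpretation fun_space: vector_space fscale
  by unfold_locales (auto simp: fscale_def fun_eq_iff algebra_simps)

definition is_basis :: "'i set \<Rightarrow> ('i \<Rightarrow> complex \<Rightarrow> complex) \<Rightarrow> (complex \<Rightarrow> complex) set \<Rightarrow> bool" where
  "is_basis I F V \<longleftrightarrow>
     inj_on F I \<and> fun_space.independent (F ` I) \<and> fun_space.span (F ` I) = V"

subsection \<open>Well-definedness\<close>

lemma openin_quotient_topology:
  "openin (quotient_topology X q) U \<longleftrightarrow>
     U \<subseteq> q ` topspace X \<and> openin X {x \<in> topspace X. q x \<in> U}"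
proof -
  have "istopology (\<lambda>U. U \<subseteq> q ` topspace X \<and> openin X {x \<in> topspace X. q x \<in> U})"
    unfolding istopology_def
  proof (intro conjI allI impI)
    fix S T
    assume "S \<subseteq> q ` topspace X \<and> openin X {x \<in> topspace X. q x \<in> S}"
      and "T \<subseteq> q ` topspace X \<and> openin X {x \<in> topspace X. q x \<in> T}"
    moreover have "{x \<in> topspace X. q x \<in> S \<inter> T} =
        {x \<in> topspace X. q x \<in> S} \<inter> {x \<in> topspace X. q x \<in> T}" by auto
    ultimately show "S \<inter> T \<subseteq> q ` topspace X" "openin X {x \<in> topspace X. q x \<in> S \<inter> T}"
      by auto
  next
    fix \<K>
    assume *: "\<forall>K\<in>\<K>. K \<subseteq> q ` topspace X \<and> openin X {x \<in> topspace X. q x \<in> K}"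
    have "{x \<in> topspace X. q x \<in> \<Union>\<K>} = (\<Union>K\<in>\<K>. {x \<in> topspace X. q x \<in> K})" by auto
    then show "\<Union>\<K> \<subseteq> q ` topspace X" "openin X {x \<in> topspace X. q x \<in> \<Union>\<K>}"
      using * by auto
  qed
  then show ?thesis
    by (simp add: quotient_topology_def topology_inverse')
qed

lemma quotient_map_quotient_topology: "quotient_map X (quotient_topology X q) q"
proof -
  have top: "topspace (quotient_topology X q) = q ` topspace X"
  proof
    show "topspace (quotient_topology X q) \<subseteq> q ` topspace X"
      using openin_topspace[of "quotient_topology X q"] unfolding openin_quotient_topology
      by (rule conjunct1)
    have "{x \<in> topspace X. q x \<in> q ` topspace X} = topspace X" by auto
    then have "openin (quotient_topology X q) (q ` topspace X)"
      by (simp add: openin_quotient_topology)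
    then show "q ` topspace X \<subseteq> topspace (quotient_topology X q)"
      by (rule openin_subset)
  qed
  show ?thesis
    unfolding quotient_map_def top openin_quotient_topology by simp
qed

lemma openin_extended_uhp_topology:
  "openin (extended_uhp_topology \<Gamma>) U \<longleftrightarrow>
     U \<subseteq> extended_uhp \<Gamma> \<and> open {z \<in> uhp. Fin z \<in> U} \<and>
       (\<forall>\<rho>\<in>carrier PSL2R. mob_sphere \<rho> Infty \<in> U \<longrightarrow>
          (\<exists>Y>0. \<forall>z. Im z > Y \<longrightarrow> mob_sphere \<rho> (Fin z) \<in> U))"
proof -
  let ?H = "\<lambda>U \<rho>. \<exists>Y>0. \<forall>z. Im z > Y \<longrightarrow> mob_sphere \<rho> (Fin z) \<in> U"
  let ?P = "\<lambda>U. U \<subseteq> extended_uhp \<Gamma> \<and> open {z \<in> uhp. Fin z \<in> U} \<and>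
       (\<forall>\<rho>\<in>carrier PSL2R. mob_sphere \<rho> Infty \<in> U \<longrightarrow> ?H U \<rho>)"
  have "istopology ?P"
    unfolding istopology_def
  proof (intro conjI[of "\<forall>S T. _ S T"] allI impI)
    fix S T assume S: "?P S" and T: "?P T"
    have "{z \<in> uhp. Fin z \<in> S \<inter> T} = {z \<in> uhp. Fin z \<in> S} \<inter> {z \<in> uhp. Fin z \<in> T}" by auto
    then have "open {z \<in> uhp. Fin z \<in> S \<inter> T}" using S T by auto
    moreover have "?H (S \<inter> T) \<rho>" if "\<rho> \<in> carrier PSL2R" "mob_sphere \<rho> Infty \<in> S \<inter> T" for \<rho>
    proof -
      have "?H S \<rho>" "?H T \<rho>" using S T that by blast+
      then obtain Y1 Y2 where Y: "Y1 > 0" "\<forall>z. Im z > Y1 \<longrightarrow> mob_sphere \<rho> (Fin z) \<in> S"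
          "\<forall>z. Im z > Y2 \<longrightarrow> mob_sphere \<rho> (Fin z) \<in> T"
        by blast
      show ?thesis
        by (rule exI[of _ "max Y1 Y2"]) (use Y in \<open>auto simp del: mob_sphere.simps\<close>)
    qed
    ultimately show "?P (S \<inter> T)" using S by blast
  next
    fix \<K> assume K: "\<forall>K\<in>\<K>. ?P K"
    have "{z \<in> uhp. Fin z \<in> \<Union>\<K>} = (\<Union>K\<in>\<K>. {z \<in> uhp. Fin z \<in> K})" by auto
    then have "open {z \<in> uhp. Fin z \<in> \<Union>\<K>}" using K by auto
    moreover have "?H (\<Union>\<K>) \<rho>" if \<rho>: "\<rho> \<in> carrier PSL2R" "mob_sphere \<rho> Infty \<in> \<Union>\<K>" for \<rho>
    proof -
      obtain S where "S \<in> \<K>" "mob_sphere \<rho> Infty \<in> S" using \<rho> by blast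
      with K \<rho> have "?H S \<rho>" by blast
      with \<open>S \<in> \<K>\<close> show ?thesis by blast
    qed
    ultimately show "?P (\<Union>\<K>)" using K by blast
  qed
  then show ?thesis
    by (simp add: extended_uhp_topology_def topology_inverse')
qed

lemma group_SL2R: "group SL2R"
proof (rule groupI)
  show "\<exists>y\<in>carrier SL2R. y \<otimes>\<^bsub>SL2R\<^esub> x = \<one>\<^bsub>SL2R\<^esub>" if "x \<in> carrier SL2R" for x
  proof -
    have "invertible x" using that by (simp add: SL2R_def invertible_det_nz)
    then obtain y where y: "y ** x = mat 1" unfolding invertible_def by blast
    have "det y * det x = 1" using arg_cong[OF y, of det] by (simp add: det_mul)
    then have "det y = 1" using that by (simp add: SL2R_def)
    then show ?thesis using y by (auto simp: SL2R_def)
  qed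
qed (auto simp: SL2R_def det_mul matrix_mul_assoc)

lemma det_uminus_2: "det (- A) = det (A :: real^2^2)"
  by (simp add: det_2)

lemma uminus_mat1_mult: "(- mat 1) ** A = - (A :: real^2^2)" "A ** (- mat 1) = - A"
  unfolding vec_eq_iff forall_2 by (simp_all add: matrix_matrix_mult_def mat_def sum_2)

lemma psl_eq: "psl A = {A, - A}"
  by (auto simp: psl_def r_coset_def SL2R_def uminus_mat1_mult)

lemma normal_pm_one: "{mat 1, - mat 1} \<lhd> SL2R"
proof -
  interpret group SL2R by (rule group_SL2R)
  have "subgroup {mat 1, - mat 1} SL2R"
  proof (rule subgroupI)
    show "inv\<^bsub>SL2R\<^esub> a \<in> {mat 1, - mat 1}" if "a \<in> {mat 1, - mat 1}" for a
    proof -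
      have "a \<otimes>\<^bsub>SL2R\<^esub> a = \<one>\<^bsub>SL2R\<^esub>" "a \<in> carrier SL2R"
        using that by (auto simp: SL2R_def det_uminus_2 uminus_mat1_mult)
      then have "inv\<^bsub>SL2R\<^esub> a = a" by (simp add: inv_equality)
      then show ?thesis using that by simp
    qed
  qed (auto simp: SL2R_def det_uminus_2 uminus_mat1_mult)
  then show ?thesis
    by (rule normalI) (auto simp: r_coset_def l_coset_def SL2R_def uminus_mat1_mult)
qed

lemma group_PSL2R: "group PSL2R"
  unfolding PSL2R_def by (rule normal.factorgroup_is_group[OF normal_pm_one])

lemma carrier_PSL2R: "carrier PSL2R = psl ` {A. det A = 1}"
  by (auto simp: PSL2R_def carrier_FactGroup psl_def SL2R_def)

lemma psl_rep_psl: "psl_rep (psl A) = A \<or> psl_rep (psl A) = - A"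
proof -
  have "psl_rep (psl A) \<in> psl A"
    unfolding psl_rep_def by (rule someI[of _ A]) (simp add: psl_eq)
  then show ?thesis by (simp add: psl_eq)
qed

lemma mob_psl:
  "mob (psl A) z = (of_real (A$1$1) * z + of_real (A$1$2)) / (of_real (A$2$1) * z + of_real (A$2$2))"
  using psl_rep_psl[of A]
proof
  assume "psl_rep (psl A) = - A"
  then have "mob (psl A) z = (- (of_real (A$1$1) * z + of_real (A$1$2))) /
      (- (of_real (A$2$1) * z + of_real (A$2$2)))"
    by (simp add: mob_def aut_factor_def)
  then show ?thesis by (simp only: minus_divide_left[symmetric] minus_divide_right[symmetric] minus_minus)
qed (simp add: mob_def aut_factor_def)

end

theory Submission
  imports Defs "HOL-Real_Asymp.Real_Asymp"
begin

text \<open>Differentiation maps the second order forms onto $S_2(\Gamma)$ with the constants as kernel.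
  If $F$ is a second order form, then each $F\circ\gamma - F$ lies in $M_0(\Gamma)$, which
  consists of constants: its elements extend holomorphically in $q = e^{2\pi i z}$ to the cusps,
  so on the compact quotient the maximum principle applies. Hence $F'$ has weight 2, and since
  $F\circ\sigma$ is a power series in $q$ at every cusp, $F'$ vanishes there. Conversely, a
  primitive $F$ of a cusp form has constant periods; at a cusp $F\circ\sigma$ is again a power
  series in $q$, so it is bounded and its parabolic periods vanish.\<close>

subsection \<open>The action of $PSL_2(R)$\<close>

text \<open>The compact quotient is available only as a topological space, without a complex
  structure, so the maximum principle is not applied on it directly. It is applied upstairs, in the
  variable z at interior points and in q at a cusp, and compactness enters only through an open
  cover. A second obstacle is that growth is prescribed at the chosen representatives alone, while
  the topology tests every \<rho> with \<rho>\<infinity> = s at every cusp s; \<Gamma>-invariance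
  and the maps z \<mapsto> m z + b fixing \<infinity> bridge this gap. The exponent c of the growth
  condition is harmless because y = -log|q| / (2 pi): a power of y is a power of a logarithm, which
  a single factor q outweighs. Parabolic invariance supplies the period 1 at a cusp. The expansion
  of F in q may have a constant term; differentiation brings down a factor q that removes it, and
  integration can put it back. This is why vanishing of F' at the cusps matches moderate growth of
  F.\<close>

lemma PSL2R_cases:
  assumes "\<gamma> \<in> carrier PSL2R"
  obtains A where "det A = 1" "\<gamma> = psl A"
  using assms by (auto simp: carrier_PSL2R)

lemma psl_mult:
  assumes "det A = 1" "det B = 1"
  shows "psl A \<otimes>\<^bsub>PSL2R\<^esub> psl B = psl (A ** B)"
  using normal.rcos_sum[OF normal_pm_one, of A B] assms
  by (simp add: PSL2R_def FactGroup_def psl_def) (simp add: SL2R_def)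

lemma one_PSL2R: "\<one>\<^bsub>PSL2R\<^esub> = psl (mat 1)"
  by (simp add: PSL2R_def FactGroup_def psl_eq)

lemma matrix_mult_2_entries:
  fixes A B :: "real^2^2"
  shows "(A ** B) $ i $ j = A$i$1 * B$1$j + A$i$2 * B$2$j"
  by (simp add: matrix_matrix_mult_def sum_2)

text \<open>\<open>psl_rep\<close> picks one of the two matrices, so cz + d is known only up to
  sign. Its square and its vanishing do not see the sign, and later arguments go through these
  two.\<close>

lemma aut_factor_psl_cases:
  "aut_factor (psl A) z = of_real (A$2$1) * z + of_real (A$2$2) \<or>
   aut_factor (psl A) z = - (of_real (A$2$1) * z + of_real (A$2$2))"
  using psl_rep_psl[of A] by (auto simp: aut_factor_def)

lemma aut_factor_psl_square:
  "(aut_factor (psl A) z)\<^sup>2 = (of_real (A$2$1) * z + of_real (A$2$2))\<^sup>2"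
  using aut_factor_psl_cases[of A z] by (metis power2_minus)

lemma aut_factor_psl_eq_0_iff:
  "aut_factor (psl A) z = 0 \<longleftrightarrow> of_real (A$2$1) * z + of_real (A$2$2) = 0"
  using aut_factor_psl_cases[of A z] by (metis neg_equal_0_iff_equal)

lemma mob_sphere_psl_Fin:
  "mob_sphere (psl A) (Fin z) =
     (if of_real (A$2$1) * z + of_real (A$2$2) = 0 then Infty
      else Fin ((of_real (A$1$1) * z + of_real (A$1$2)) / (of_real (A$2$1) * z + of_real (A$2$2))))"
  by (simp add: aut_factor_psl_eq_0_iff mob_psl)

lemma mob_sphere_psl_Infty:
  "mob_sphere (psl A) Infty =
     (if A$2$1 = 0 then Infty else Fin (of_real (A$1$1) / of_real (A$2$1)))"
  using psl_rep_psl[of A] by auto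

lemma complex_det_2:
  fixes A :: "real^2^2"
  assumes "det A = 1"
  shows "complex_of_real (A$1$1) * of_real (A$2$2) - of_real (A$1$2) * of_real (A$2$1) = 1"
  using arg_cong[OF assms[unfolded det_2], of complex_of_real] by simp

text \<open>Determinant 1 keeps numerator and denominator from vanishing together, so the cases
  passing through a pole or through \<infinity> also compose. Working on the sphere treats cusps and
  interior points at once; \<open>mob_mult\<close> is the restriction to the half plane.\<close>

lemma mob_sphere_mult:
  assumes "\<alpha> \<in> carrier PSL2R" "\<beta> \<in> carrier PSL2R"
  shows "mob_sphere (\<alpha> \<otimes>\<^bsub>PSL2R\<^esub> \<beta>) x = mob_sphere \<alpha> (mob_sphere \<beta> x)"
proof -
  obtain A B where A: "det A = 1" "\<alpha> = psl A" and B: "det B = 1" "\<beta> = psl B"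
    using assms by (meson PSL2R_cases)
  define a b c d where "a = complex_of_real (A$1$1)" and "b = complex_of_real (A$1$2)"
    and "c = complex_of_real (A$2$1)" and "d = complex_of_real (A$2$2)"
  define p q r s where "p = complex_of_real (B$1$1)" and "q = complex_of_real (B$1$2)"
    and "r = complex_of_real (B$2$1)" and "s = complex_of_real (B$2$2)"
  have dA: "a * d - b * c = 1" and dB: "p * s - q * r = 1"
    using complex_det_2[OF A(1)] complex_det_2[OF B(1)]
    by (simp_all add: a_def b_def c_def d_def p_def q_def r_def s_def)
  have FinA: "mob_sphere \<alpha> (Fin z) =
      (if c * z + d = 0 then Infty else Fin ((a * z + b) / (c * z + d)))" for z
    by (simp only: A(2) mob_sphere_psl_Fin a_def b_def c_def d_def)
  have InfA: "mob_sphere \<alpha> Infty = (if c = 0 then Infty else Fin (a / c))"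
    by (simp only: A(2) mob_sphere_psl_Infty a_def c_def of_real_eq_0_iff)
  have FinB: "mob_sphere \<beta> (Fin z) =
      (if r * z + s = 0 then Infty else Fin ((p * z + q) / (r * z + s)))" for z
    by (simp only: B(2) mob_sphere_psl_Fin p_def q_def r_def s_def)
  have InfB: "mob_sphere \<beta> Infty = (if r = 0 then Infty else Fin (p / r))"
    by (simp only: B(2) mob_sphere_psl_Infty p_def r_def of_real_eq_0_iff)
  have FinAB: "mob_sphere (\<alpha> \<otimes>\<^bsub>PSL2R\<^esub> \<beta>) (Fin z) =
      (if (c * p + d * r) * z + (c * q + d * s) = 0 then Infty
       else Fin (((a * p + b * r) * z + (a * q + b * s)) / ((c * p + d * r) * z + (c * q + d * s))))" for z
    by (simp only: A(2) B(2) psl_mult[OF A(1) B(1)] mob_sphere_psl_Fin matrix_mult_2_entries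
        of_real_add of_real_mult a_def b_def c_def d_def p_def q_def r_def s_def)
  have InfAB: "mob_sphere (\<alpha> \<otimes>\<^bsub>PSL2R\<^esub> \<beta>) Infty =
      (if c * p + d * r = 0 then Infty else Fin ((a * p + b * r) / (c * p + d * r)))"
    by (simp only: A(2) B(2) psl_mult[OF A(1) B(1)] mob_sphere_psl_Infty matrix_mult_2_entries
        of_real_add[symmetric] of_real_mult[symmetric] of_real_eq_0_iff
        a_def b_def c_def d_def p_def q_def r_def s_def)
  show ?thesis
  proof (cases x)
    case (Fin z)
    show ?thesis
    proof (cases "r * z + s = 0")
      case True
      have "p * z + q \<noteq> 0"
      proof
        assume "p * z + q = 0"
        then have "p * s - q * r = 0" using True by algebra
        then show False using dB by simp
      qed
      moreover have "(c * p + d * r) * z + (c * q + d * s) = c * (p * z + q)"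
        using True by algebra
      moreover have "(a * p + b * r) * z + (a * q + b * s) = a * (p * z + q)"
        using True by algebra
      ultimately show ?thesis using True by (simp add: Fin FinB FinAB InfA del: mob_sphere.simps)
    next
      case False
      have "(c * p + d * r) * z + (c * q + d * s) = (c * ((p * z + q) / (r * z + s)) + d) * (r * z + s)"
        using False by (simp add: field_simps)
      moreover have "(a * p + b * r) * z + (a * q + b * s) = (a * ((p * z + q) / (r * z + s)) + b) * (r * z + s)"
        using False by (simp add: field_simps)
      ultimately show ?thesis using False by (simp add: Fin FinB FinAB FinA del: mob_sphere.simps)
    qed
  next
    case Infty
    show ?thesis
    proof (cases "r = 0")
      case True
      then have "p \<noteq> 0" using dB by auto
      then show ?thesis using True by (simp add: Infty InfAB InfB InfA del: mob_sphere.simps)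
    next
      case False
      have "c * p + d * r = (c * (p / r) + d) * r" "a * p + b * r = (a * (p / r) + b) * r"
        using False by (simp_all add: field_simps)
      then show ?thesis using False by (simp add: Infty InfAB InfB FinA del: mob_sphere.simps)
    qed
  qed
qed

lemma mob_sphere_one: "mob_sphere \<one>\<^bsub>PSL2R\<^esub> x = x"
  by (cases x) (simp_all only: one_PSL2R mob_sphere_psl_Fin mob_sphere_psl_Infty, simp_all add: mat_def)

lemma mob_sphere_inv:
  assumes "\<gamma> \<in> carrier PSL2R"
  shows "mob_sphere (inv\<^bsub>PSL2R\<^esub> \<gamma>) (mob_sphere \<gamma> x) = x"
    and "mob_sphere \<gamma> (mob_sphere (inv\<^bsub>PSL2R\<^esub> \<gamma>) x) = x"
  using assms group_PSL2R
  by (simp_all add: mob_sphere_mult[symmetric] mob_sphere_one group.l_inv group.r_inv del: mob_sphere.simps)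

section \<open>Moebius maps on the upper half plane\<close>

lemma denominator_nonzero:
  fixes A :: "real^2^2"
  assumes "det A = 1" "z \<in> uhp"
  shows "complex_of_real (A$2$1) * z + of_real (A$2$2) \<noteq> 0"
proof
  assume 0: "complex_of_real (A$2$1) * z + of_real (A$2$2) = 0"
  then have "Im (complex_of_real (A$2$1) * z + of_real (A$2$2)) = 0" by simp
  then have "A$2$1 = 0" using assms by (simp add: uhp_def)
  with 0 have "A$2$2 = 0" by simp
  with \<open>A$2$1 = 0\<close> show False using assms by (simp add: det_2)
qed

lemma aut_factor_nonzero:
  assumes "\<gamma> \<in> carrier PSL2R" "z \<in> uhp"
  shows "aut_factor \<gamma> z \<noteq> 0"
  using assms by (metis PSL2R_cases aut_factor_psl_eq_0_iff denominator_nonzero)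

lemma mob_in_uhp:
  assumes "\<gamma> \<in> carrier PSL2R" "z \<in> uhp"
  shows "mob \<gamma> z \<in> uhp"
proof -
  obtain A where A: "det A = 1" "\<gamma> = psl A" using assms by (meson PSL2R_cases)
  let ?w = "complex_of_real (A$2$1) * z + of_real (A$2$2)"
  have w: "?w \<noteq> 0" by (rule denominator_nonzero[OF A(1) assms(2)])
  have d: "A$1$1 * A$2$2 - A$1$2 * A$2$1 = 1" using A(1) by (simp add: det_2)
  have "Im (mob \<gamma> z) = (A$1$1 * A$2$2 - A$1$2 * A$2$1) * Im z / (norm ?w)\<^sup>2"
    unfolding A(2) mob_psl Im_divide cmod_power2 by (simp add: algebra_simps)
  also have "\<dots> > 0" using w d assms(2) by (simp add: uhp_def)
  finally show ?thesis by (simp add: uhp_def)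
qed

lemma mob_sphere_Fin_uhp:
  assumes "\<gamma> \<in> carrier PSL2R" "z \<in> uhp"
  shows "mob_sphere \<gamma> (Fin z) = Fin (mob \<gamma> z)"
  using aut_factor_nonzero[OF assms] by simp

lemma mob_mult:
  assumes "\<alpha> \<in> carrier PSL2R" "\<beta> \<in> carrier PSL2R" "z \<in> uhp"
  shows "mob (\<alpha> \<otimes>\<^bsub>PSL2R\<^esub> \<beta>) z = mob \<alpha> (mob \<beta> z)"
proof -
  have "\<alpha> \<otimes>\<^bsub>PSL2R\<^esub> \<beta> \<in> carrier PSL2R"
    using assms group_PSL2R by (meson group.subgroup_self subgroup.m_closed)
  then show ?thesis
    using mob_sphere_mult[OF assms(1,2), of "Fin z"] assms
    by (simp add: mob_sphere_Fin_uhp mob_in_uhp del: mob_sphere.simps)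
qed

lemma mob_inv:
  assumes "\<gamma> \<in> carrier PSL2R" "z \<in> uhp"
  shows "mob (inv\<^bsub>PSL2R\<^esub> \<gamma>) (mob \<gamma> z) = z" "mob \<gamma> (mob (inv\<^bsub>PSL2R\<^esub> \<gamma>) z) = z"
proof -
  have "inv\<^bsub>PSL2R\<^esub> \<gamma> \<in> carrier PSL2R" by (simp add: assms(1) group.inv_closed group_PSL2R)
  then show "mob (inv\<^bsub>PSL2R\<^esub> \<gamma>) (mob \<gamma> z) = z" "mob \<gamma> (mob (inv\<^bsub>PSL2R\<^esub> \<gamma>) z) = z"
    using mob_sphere_inv[OF assms(1), of "Fin z"] assms
    by (simp_all add: mob_sphere_Fin_uhp mob_in_uhp del: mob_sphere.simps)
qed

text \<open>The quotient rule leaves a(cz + d) - c(az + b) = det A = 1 in the numerator. The square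
  in the denominator is the source of weight 2, and it removes the sign ambiguity.\<close>

lemma mob_has_field_derivative:
  assumes "\<gamma> \<in> carrier PSL2R" "z \<in> uhp"
  shows "(mob \<gamma> has_field_derivative 1 / (aut_factor \<gamma> z)\<^sup>2) (at z)"
proof -
  obtain A where A: "det A = 1" "\<gamma> = psl A" using assms by (meson PSL2R_cases)
  let ?w = "complex_of_real (A$2$1) * z + of_real (A$2$2)"
  have w: "?w \<noteq> 0" by (rule denominator_nonzero[OF A(1) assms(2)])
  have "of_real (A$1$1) * ?w - (of_real (A$1$1) * z + of_real (A$1$2)) * of_real (A$2$1) = 1"
    using complex_det_2[OF A(1)] by (simp add: algebra_simps)
  then have "(mob (psl A) has_field_derivative 1 / ?w\<^sup>2) (at z)"
    unfolding mob_psl[abs_def] using w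
    by (auto intro!: derivative_eq_intros simp: power2_eq_square)
  then show ?thesis by (simp add: A(2) aut_factor_psl_square)
qed

section \<open>Translations, the stabilizer of infinity and parabolic elements\<close>

lemma mob_translation: "mob (psl (translation_matrix n)) z = z + of_int n"
  by (simp add: mob_psl translation_matrix_def)

lemma det_translation: "det (translation_matrix n) = 1"
  by (simp add: det_2 translation_matrix_def)

text \<open>Here c = 0 and ad = 1, so 1/d = a and the map is z \<mapsto> a^2 z + ab. Two elements
  sending \<infinity> to the same cusp differ by such a map, so their horoballs differ only by
  rescaling the height.\<close>

lemma mob_stabilizer_Infty:
  assumes "\<tau> \<in> carrier PSL2R" "mob_sphere \<tau> Infty = Infty"
  obtains m where "m > 0" "\<And>z. Im (mob \<tau> z) = m * Im z"
proof -
  obtain A where A: "det A = 1" "\<tau> = psl A" using assms by (meson PSL2R_cases)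
  have c: "A$2$1 = 0" using assms(2) A by (simp add: mob_sphere_psl_Infty split: if_splits del: mob_sphere.simps)
  then have ad: "A$1$1 * A$2$2 = 1" using A by (simp add: det_2)
  show ?thesis
  proof
    show "(A$1$1)\<^sup>2 > 0" using ad by auto
    show "Im (mob \<tau> z) = (A$1$1)\<^sup>2 * Im z" for z
    proof -
      have "mob \<tau> z = (of_real (A$1$1) * z + of_real (A$1$2)) / of_real (A$2$2)"
        by (simp add: A(2) mob_psl c)
      also have "inverse (A$2$2) = A$1$1" using ad by (metis inverse_unique mult.commute)
      then have "1 / complex_of_real (A$2$2) = of_real (A$1$1)"
        by (metis inverse_eq_divide of_real_inverse)
      then have "(of_real (A$1$1) * z + of_real (A$1$2)) / of_real (A$2$2)
          = (of_real (A$1$1) * z + of_real (A$1$2)) * of_real (A$1$1)"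
        by (metis divide_inverse inverse_eq_divide)
      finally show ?thesis by (simp add: power2_eq_square)
    qed
  qed
qed

text \<open>For c \<noteq> 0 the fixed points are the roots of c x^2 + (d - a) x - b, whose
  discriminant is (a + d)^2 - 4 = 0. The double root (a - d) / (2c) is real, and there the
  denominator is half the trace, hence nonzero.\<close>

lemma parabolic_fixes_boundary_point:
  assumes "parabolic \<pi>"
  obtains s where "s \<in> boundary_circle" "mob_sphere \<pi> s = s"
proof -
  have "\<pi> \<in> carrier PSL2R" using assms by (simp add: parabolic_def)
  then obtain A where A: "det A = 1" "\<pi> = psl A" by (meson PSL2R_cases)
  have "\<bar>trace A\<bar> = 2"
    using assms psl_rep_psl[of A] unfolding parabolic_def A(2) by (auto simp: trace_def sum_2)
  then have "\<bar>A$1$1 + A$2$2\<bar> = 2" by (simp add: trace_def sum_2)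
  then have tr: "(A$1$1 + A$2$2)\<^sup>2 = 4" by (simp add: abs_eq_iff' power2_eq_iff[of _ 2, simplified])
  show ?thesis
  proof (cases "A$2$1 = 0")
    case True
    then show ?thesis
      by (intro that[of Infty]) (auto simp: boundary_circle_def A(2) mob_sphere_psl_Infty simp del: mob_sphere.simps)
  next
    case False
    define x where "x = (A$1$1 - A$2$2) / (2 * A$2$1)"
    have den: "A$2$1 * x + A$2$2 = (A$1$1 + A$2$2) / 2"
      using False by (simp add: x_def field_simps)
    have den0: "A$2$1 * x + A$2$2 \<noteq> 0" unfolding den using tr by auto
    have "A$1$1 * x + A$1$2 = x * (A$2$1 * x + A$2$2)"
    proof -
      have d: "A$1$1 * A$2$2 - A$1$2 * A$2$1 = 1" using A(1) by (simp add: det_2)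
      have x2: "2 * A$2$1 * x = A$1$1 - A$2$2" using False by (simp add: x_def)
      have "4 * A$2$1 * (A$1$1 * x + A$1$2 - x * (A$2$1 * x + A$2$2)) = 0"
        using d x2 tr by algebra
      then show ?thesis using False by simp
    qed
    then have "(complex_of_real (A$1$1) * of_real x + of_real (A$1$2)) =
       of_real x * (of_real (A$2$1) * of_real x + of_real (A$2$2))"
      by (simp flip: of_real_add of_real_mult)
    moreover have "complex_of_real (A$2$1) * of_real x + of_real (A$2$2) \<noteq> 0"
      using den0 by (metis of_real_add of_real_mult of_real_eq_0_iff)
    ultimately have "mob_sphere \<pi> (Fin (of_real x)) = Fin (of_real x)"
      by (simp add: A(2) mob_sphere_psl_Fin del: mob_sphere.simps)
    then show ?thesis by (intro that[of "Fin (of_real x)"]) (auto simp: boundary_circle_def)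
  qed
qed

text \<open>Conjugation preserves the trace, up to the sign lost in the quotient. The identity also
  has trace 2 in absolute value, so it is excluded separately: it would force the translation by 1
  to be trivial.\<close>

lemma parabolic_conjugate_translation:
  assumes "\<rho> \<in> carrier PSL2R" "\<pi> \<in> carrier PSL2R"
    and conj: "inv\<^bsub>PSL2R\<^esub> \<rho> \<otimes>\<^bsub>PSL2R\<^esub> \<pi> \<otimes>\<^bsub>PSL2R\<^esub> \<rho> = psl (translation_matrix 1)"
  shows "parabolic \<pi>"
proof -
  interpret group PSL2R by (rule group_PSL2R)
  obtain A S where A: "det A = 1" "\<pi> = psl A" and S: "det S = 1" "\<rho> = psl S"
    using assms by (meson PSL2R_cases)
  let ?T = "translation_matrix 1"
  have "\<pi> \<otimes>\<^bsub>PSL2R\<^esub> \<rho> = \<rho> \<otimes>\<^bsub>PSL2R\<^esub> psl ?T"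
    unfolding conj[symmetric] using assms(1,2) by (simp add: m_assoc[symmetric])
  then have "psl (A ** S) = psl (S ** ?T)"
    using A S by (simp add: psl_mult det_translation)
  then have AS: "A ** S = S ** ?T \<or> A ** S = - (S ** ?T)"
    by (auto simp: psl_eq doubleton_eq_iff)
  have "invertible S" using S(1) by (simp add: invertible_det_nz)
  \<comment> \<open>\<open>R\<close> is the matrix inverse of \<open>S\<close>; the trace is
    computed with matrices, since classes carry no trace.\<close>
  then obtain R where R: "S ** R = mat 1" "R ** S = mat 1" unfolding invertible_def by blast
  have "trace A = trace (A ** S ** R)"
    by (metis R(1) matrix_mul_assoc matrix_mul_rid)
  also have "\<dots> = trace (R ** (A ** S))" by (rule trace_mul_sym)
  finally have trA: "trace A = trace (R ** (A ** S))" .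
  have RST: "R ** (S ** ?T) = ?T" by (simp add: matrix_mul_assoc R)
  have neg: "R ** (- X) = - (R ** X)" for X :: "real^2^2"
    by (simp add: vec_eq_iff matrix_mult_2_entries algebra_simps)
  have "\<bar>trace A\<bar> = 2"
  proof -
    have "trace ?T = 2" "trace (- ?T) = - 2"
      by (simp_all add: trace_def sum_2 translation_matrix_def)
    with AS show ?thesis by (auto simp only: trA neg RST)
  qed
  then have "\<bar>trace (psl_rep \<pi>)\<bar> = 2"
    using psl_rep_psl[of A] unfolding A(2) by (auto simp: trace_def sum_2)
  moreover have "\<pi> \<noteq> \<one>\<^bsub>PSL2R\<^esub>"
  proof
    assume "\<pi> = \<one>\<^bsub>PSL2R\<^esub>"
    then have "psl ?T = \<one>\<^bsub>PSL2R\<^esub>" using conj assms(1) by simp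
    then have "?T = mat 1 \<or> ?T = - mat 1" by (auto simp: one_PSL2R psl_eq doubleton_eq_iff)
    then have "?T $ 1 $ 2 = 0" by (auto simp: mat_def)
    then show False by (simp add: translation_matrix_def)
  qed
  ultimately show ?thesis using assms(2) by (simp add: parabolic_def)
qed

subsection \<open>Expansions at infinity\<close>

lemma open_uhp: "open uhp"
  unfolding uhp_def by (rule open_halfspace_Im_gt)

lemma convex_uhp: "convex uhp"
  unfolding uhp_def by (rule convex_halfspace_Im_gt)

lemma uhp_constant_if_derivative_zero:
  assumes "\<And>z. z \<in> uhp \<Longrightarrow> (f has_field_derivative 0) (at z)"
  obtains c where "\<And>z. z \<in> uhp \<Longrightarrow> f z = c"
proof -
  have "\<exists>c. \<forall>z\<in>uhp. f z = c"
    by (rule has_field_derivative_zero_constant[OF convex_uhp])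
       (use assms has_field_derivative_at_within in blast)
  then show ?thesis using that by blast
qed

section \<open>The local coordinate q at a cusp of width one\<close>

definition qexp :: "complex \<Rightarrow> complex" where
  "qexp z = exp (2 * of_real pi * \<i> * z)"

lemma norm_qexp: "norm (qexp z) = exp (- 2 * pi * Im z)"
  by (simp add: qexp_def)

lemma qexp_in_ball: "z \<in> uhp \<Longrightarrow> qexp z \<in> ball 0 1"
  by (simp add: norm_qexp uhp_def)

lemma qexp_nonzero [simp]: "qexp z \<noteq> 0"
  by (simp add: qexp_def)

lemma qexp_add_int: "qexp (z + of_int n) = qexp z"
  unfolding qexp_def exp_eq by (rule exI[of _ n]) (simp add: algebra_simps)

lemma qexp_eq_imp:
  assumes "qexp z = qexp w"
  obtains n :: int where "z = w + of_int n"
proof -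
  obtain n :: int where "2 * of_real pi * \<i> * z = 2 * of_real pi * \<i> * w + of_int (2 * n) * pi * \<i>"
    using assms unfolding qexp_def exp_eq by blast
  then have "(2 * of_real pi * \<i>) * z = (2 * of_real pi * \<i>) * (w + of_int n)"
    by (simp add: algebra_simps)
  then have "z = w + of_int n" by (subst (asm) mult_cancel_left) simp
  then show ?thesis by (rule that)
qed

lemma qexp_surj:
  assumes "q \<noteq> 0" "norm q < 1"
  obtains z where "z \<in> uhp" "qexp z = q" "Im z = - ln (norm q) / (2 * pi)"
proof -
  define z where "z = Ln q / (2 * of_real pi * \<i>)"
  have q: "qexp z = q" using assms by (simp add: z_def qexp_def)
  have "ln (norm q) = - 2 * pi * Im z" using norm_qexp[of z] unfolding q by simp
  then have Im: "Im z = - ln (norm q) / (2 * pi)" by simp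
  moreover have "ln (norm q) < 0" using assms by simp
  ultimately have "z \<in> uhp" by (simp add: uhp_def divide_neg_pos)
  with q Im show ?thesis by (rule that[rotated])
qed

lemma has_field_derivative_qexp:
  "(qexp has_field_derivative 2 * of_real pi * \<i> * qexp z) (at z within S)"
  unfolding qexp_def[abs_def] by (auto intro!: derivative_eq_intros)

lemma periodic_int:
  fixes H :: "complex \<Rightarrow> 'a"
  assumes "\<And>z. z \<in> uhp \<Longrightarrow> H (z + 1) = H z" "z \<in> uhp"
  shows "H (z + of_int n) = H z"
proof (induction n rule: int_induct[where k = 0])
  case (step1 n)
  have "z + of_int n \<in> uhp" using assms(2) by (simp add: uhp_def)
  from assms(1)[OF this] step1 show ?case by (simp add: algebra_simps)
next
  case (step2 n)
  have "z + of_int (n - 1) \<in> uhp" using assms(2) by (simp add: uhp_def)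
  from assms(1)[OF this] step2 show ?case by (simp add: algebra_simps)
qed simp

section \<open>Functions on the half plane as functions of q\<close>

lemma mult_log_powr_tendsto_0:
  "((\<lambda>x::real. x * (- ln x / (2 * pi)) powr c) \<longlongrightarrow> 0) (at_right 0)"
  by real_asymp

text \<open>Period 1 lets H descend to the punctured disc. The bound by a power of y grows there
  only like a power of log|q|, too slowly for a pole, so the singularity at q = 0 is
  removable.\<close>

lemma periodic_moderate_q_expansion:
  fixes H :: "complex \<Rightarrow> complex"
  assumes hol: "H holomorphic_on uhp"
    and per: "\<And>z. z \<in> uhp \<Longrightarrow> H (z + 1) = H z"
    and growth: "\<And>z. Im z \<ge> Y \<Longrightarrow> norm (H z) \<le> K * Im z powr c"
  obtains G where "G holomorphic_on ball 0 1" "\<And>z. z \<in> uhp \<Longrightarrow> H z = G (qexp z)"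
proof -
  \<comment> \<open>An arbitrary preimage of q. Its imaginary part is forced by |q| and is recorded
    to translate the growth bound into a bound in |q|.\<close>
  define \<zeta> where "\<zeta> q = (SOME z. z \<in> uhp \<and> qexp z = q \<and> Im z = - ln (norm q) / (2 * pi))" for q
  have \<zeta>: "\<zeta> q \<in> uhp" "qexp (\<zeta> q) = q" "Im (\<zeta> q) = - ln (norm q) / (2 * pi)"
    if "q \<noteq> 0" "norm q < 1" for q
    using someI_ex[of "\<lambda>z. z \<in> uhp \<and> qexp z = q \<and> Im z = - ln (norm q) / (2 * pi)"]
      qexp_surj[OF that] unfolding \<zeta>_def by metis+
  define G0 where "G0 q = H (\<zeta> q)" for q
  have G0: "G0 (qexp z) = H z" if z: "z \<in> uhp" for z
  proof -
    have "qexp z \<noteq> 0" "norm (qexp z) < 1" using qexp_in_ball[OF z] by simp_all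
    note Z = \<zeta>[OF this]
    obtain n :: int where "\<zeta> (qexp z) = z + of_int n" using Z(2) by (rule qexp_eq_imp)
    then show ?thesis using periodic_int[of H, OF per z] by (simp add: G0_def)
  qed
  have hol0: "G0 holomorphic_on ball 0 1 - {0}"
  proof (rule holomorphic_onI)
    fix q assume "q \<in> ball (0::complex) 1 - {0}"
    then have q: "q \<noteq> 0" "norm q < 1" by auto
    \<comment> \<open>A branch of the logarithm near \<open>q\<close>: periodicity makes \<open>G0\<close> independent of the branch.\<close>
    define \<psi> where "\<psi> p = \<zeta> q + Ln (p / q) / (2 * of_real pi * \<i>)" for p
    have d\<psi>: "(\<psi> has_field_derivative (1 / q) / (2 * of_real pi * \<i>)) (at q)"
      unfolding \<psi>_def using q(1)
      by (auto intro!: derivative_eq_intros simp: field_simps)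
    have \<psi>q: "\<psi> q = \<zeta> q" using q by (simp add: \<psi>_def)
    have "H field_differentiable at (\<psi> q)"
      unfolding \<psi>q using hol \<zeta>(1)[OF q] holomorphic_on_imp_differentiable_at open_uhp by blast
    then obtain D where "(H has_field_derivative D) (at (\<psi> q))"
      unfolding field_differentiable_def by blast
    from DERIV_chain2[OF this d\<psi>]
    have "((\<lambda>p. H (\<psi> p)) has_field_derivative D * ((1 / q) / (2 * of_real pi * \<i>))) (at q)" .
    moreover have "eventually (\<lambda>p. H (\<psi> p) = G0 p) (nhds q)"
    proof -
      have "isCont \<psi> q" using d\<psi> by (rule DERIV_isCont)
      then have "eventually (\<lambda>p. \<psi> p \<in> uhp) (at q)"
        using \<zeta>(1)[OF q] \<psi>q open_uhp unfolding isCont_def by (auto dest: topological_tendstoD)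
      then have "eventually (\<lambda>p. \<psi> p \<in> uhp) (nhds q)"
        using \<zeta>(1)[OF q] \<psi>q by (simp add: eventually_nhds_conv_at)
      moreover have "eventually (\<lambda>p. p \<noteq> 0) (nhds q)"
        using q(1) by (rule t1_space_nhds)
      ultimately show ?thesis
      proof eventually_elim
        case (elim p)
        have "qexp (\<psi> p) = qexp (\<zeta> q) * exp (Ln (p / q))"
          by (simp add: qexp_def \<psi>_def exp_add[symmetric] algebra_simps)
        also have "\<dots> = p" using \<zeta>(2)[OF q] q(1) elim(2) by simp
        finally show ?case using G0[OF elim(1)] by simp
      qed
    qed
    ultimately have "(G0 has_field_derivative D * ((1 / q) / (2 * of_real pi * \<i>))) (at q)"
      using DERIV_cong_ev[OF refl _ refl, of "\<lambda>p. H (\<psi> p)" G0 q] by blast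
    then show "G0 field_differentiable at q within ball 0 1 - {0}"
      using field_differentiable_at_within field_differentiable_def by blast
  qed
  \<comment> \<open>Riemann's criterion: the extension exists as soon as q times the function tends
    to 0.\<close>
  have "((\<lambda>q. (q - 0) * G0 q) \<longlongrightarrow> 0) (at 0)"
  proof (rule Lim_null_comparison)
    have r: "filterlim (\<lambda>q::complex. norm q) (at_right 0) (at 0)"
      by (auto simp: filterlim_at eventually_at_filter intro!: tendsto_norm_zero)
    have "((\<lambda>q::complex. norm q * (- ln (norm q) / (2 * pi)) powr c) \<longlongrightarrow> 0) (at 0)"
      by (rule filterlim_compose[OF mult_log_powr_tendsto_0 r])
    from tendsto_mult_left[OF this, of K]
    show "((\<lambda>q::complex. K * (norm q * (- ln (norm q) / (2 * pi)) powr c)) \<longlongrightarrow> 0) (at 0)"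
      by simp
    \<comment> \<open>Small |q| means large height, so the preimage eventually lies where the growth
      bound holds.\<close>
    have "eventually (\<lambda>x::real. - ln x / (2 * pi) \<ge> Y) (at_right 0)" by real_asymp
    then have "eventually (\<lambda>q::complex. - ln (norm q) / (2 * pi) \<ge> Y) (at 0)"
      using r by (rule eventually_compose_filterlim)
    moreover have "eventually (\<lambda>q::complex. q \<noteq> 0) (at 0)"
      by (simp add: eventually_at_filter)
    moreover have "eventually (\<lambda>q::complex. norm q < 1) (at 0)"
      using eventually_at_ball[of 1 "0::complex" UNIV] by (simp add: dist_norm)
    ultimately show "eventually (\<lambda>q. norm ((q - 0) * G0 q)
        \<le> K * (norm q * (- ln (norm q) / (2 * pi)) powr c)) (at 0)"
    proof eventually_elim
      case (elim q)
      note Z = \<zeta>(3)[OF elim(2,3)]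
      have "norm (G0 q) \<le> K * (- ln (norm q) / (2 * pi)) powr c"
        using growth[of "\<zeta> q"] elim(1) unfolding Z G0_def by blast
      then have "norm q * norm (G0 q) \<le> norm q * (K * (- ln (norm q) / (2 * pi)) powr c)"
        by (rule mult_left_mono) simp
      then show ?case by (simp add: norm_mult algebra_simps)
    qed
  qed
  then obtain G where G: "G holomorphic_on ball 0 1" "\<forall>q\<in>ball 0 1 - {0}. G q = G0 q"
    using holomorphic_on_extend_lim[OF hol0] by auto
  show ?thesis
  proof (rule that[OF G(1)])
    fix z assume z: "z \<in> uhp"
    then show "H z = G (qexp z)" using G0[OF z] G(2) qexp_in_ball[OF z] by simp
  qed
qed

text \<open>The chain rule gives H' = 2 pi i q G'(q). The extra factor q shifts the expansion to
  start at q^1, which is the exponent \<open>Suc n\<close> in the cusp condition of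
  \<open>S2\<close>.\<close>

lemma q_expansion_of_derivative:
  assumes G: "G holomorphic_on ball 0 1" and H: "\<And>z. z \<in> uhp \<Longrightarrow> H z = G (qexp z)"
  obtains b where
    "\<And>z. z \<in> uhp \<Longrightarrow> (\<lambda>n. b n * exp (2 * of_real pi * \<i> * of_nat (Suc n) * z)) sums deriv H z"
proof -
  have dG: "deriv G holomorphic_on ball 0 1" by (rule holomorphic_deriv[OF G open_ball])
  define a where "a n = (deriv ^^ n) (deriv G) 0 / fact n" for n
  show ?thesis
  proof (rule that[of "\<lambda>n. 2 * of_real pi * \<i> * a n"])
    fix z assume z: "z \<in> uhp"
    note q = qexp_in_ball[OF z]
    have "(\<lambda>n. a n * qexp z ^ n) sums deriv G (qexp z)"
      using holomorphic_power_series[OF dG q] by (simp add: a_def)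
    then have "(\<lambda>n. (2 * of_real pi * \<i> * qexp z) * (a n * qexp z ^ n)) sums
        ((2 * of_real pi * \<i> * qexp z) * deriv G (qexp z))"
      by (rule sums_mult)
    moreover have "(2 * of_real pi * \<i> * qexp z) * (a n * qexp z ^ n)
        = 2 * of_real pi * \<i> * a n * exp (2 * of_real pi * \<i> * of_nat (Suc n) * z)" for n
    proof -
      have "exp (2 * of_real pi * \<i> * of_nat (Suc n) * z) = qexp z ^ Suc n"
        unfolding qexp_def exp_of_nat_mult[symmetric] by (simp only: mult_ac)
      then show ?thesis by simp
    qed
    moreover have "deriv H z = (2 * of_real pi * \<i> * qexp z) * deriv G (qexp z)"
    proof (rule DERIV_imp_deriv)
      have "(G has_field_derivative deriv G (qexp z)) (at (qexp z))"
        using holomorphic_derivI[OF G open_ball q] .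
      from DERIV_chain2[OF this has_field_derivative_qexp]
      have "((\<lambda>z. G (qexp z)) has_field_derivative deriv G (qexp z) * (2 * of_real pi * \<i> * qexp z)) (at z)" .
      then have "(H has_field_derivative deriv G (qexp z) * (2 * of_real pi * \<i> * qexp z)) (at z)"
        by (rule has_field_derivative_transform_within_open[OF _ open_uhp z]) (simp add: H)
      then show "(H has_field_derivative (2 * of_real pi * \<i> * qexp z) * deriv G (qexp z)) (at z)"
        by (simp add: mult_ac)
    qed
    ultimately show "(\<lambda>n. 2 * of_real pi * \<i> * a n * exp (2 * of_real pi * \<i> * of_nat (Suc n) * z)) sums deriv H z"
      by simp
  qed
qed

text \<open>Since the expansion of h starts at q^1, the quotient h/q is a power series B without a
  pole. With P' = B and dq = 2 pi i q dz, the functions H and P(q) / (2 pi i) have the same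
  derivative and differ by a constant. Without the missing constant term a summand linear in z would
  appear.\<close>

lemma q_expansion_of_primitive:
  assumes b: "\<And>z. z \<in> uhp \<Longrightarrow> (\<lambda>n. b n * exp (2 * of_real pi * \<i> * of_nat (Suc n) * z)) sums h z"
    and H: "\<And>z. z \<in> uhp \<Longrightarrow> (H has_field_derivative h z) (at z)"
  obtains G where "G holomorphic_on ball 0 1" "\<And>z. z \<in> uhp \<Longrightarrow> H z = G (qexp z)"
proof -
  have ex: "exp (2 * of_real pi * \<i> * of_nat (Suc n) * z) = qexp z * qexp z ^ n" for n z
  proof -
    have "exp (2 * of_real pi * \<i> * of_nat (Suc n) * z) = exp (of_nat (Suc n) * (2 * of_real pi * \<i> * z))"
      by (simp only: mult_ac)
    then show ?thesis by (simp only: exp_of_nat_mult qexp_def power_Suc)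
  qed
  have b': "(\<lambda>n. b n * qexp z ^ n) sums (h z / qexp z)" if "z \<in> uhp" for z
    using sums_divide[OF b[OF that], of "qexp z"] by (simp add: ex del: of_nat_Suc)
  \<comment> \<open>Every nonzero q in the disc is the image of a point of the half plane, so the
    assumed convergence there gives convergence on the full disc.\<close>
  have summ: "summable (\<lambda>n. b n * q ^ n)" if q: "q \<in> ball 0 1" for q
  proof (cases "q = 0")
    case False
    then obtain z where "z \<in> uhp" "qexp z = q" using q qexp_surj[of q] by auto
    then show ?thesis using b' sums_summable by blast
  qed (simp add: summable_0_powser)
  define B where "B q = (\<Sum>n. b n * q ^ n)" for q
  have "B holomorphic_on ball 0 1"
    by (rule power_series_holomorphic[where a = b]) (use summ in \<open>simp add: B_def summable_sums\<close>)
  then obtain P where P: "\<And>q. q \<in> ball 0 1 \<Longrightarrow> (P has_field_derivative B q) (at q within ball 0 1)"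
    using holomorphic_convex_primitive'[OF convex_ball open_ball] by blast
  then have P': "(P has_field_derivative B q) (at q)" if "q \<in> ball 0 1" for q
    using at_within_open[OF that open_ball] that by metis
  have hB: "h z = qexp z * B (qexp z)" if "z \<in> uhp" for z
    using sums_unique[OF b'[OF that]] by (simp add: B_def field_simps)
  define R where "R = (\<lambda>z. H z - P (qexp z) / (2 * of_real pi * \<i>))"
  have "(R has_field_derivative 0) (at z)" if z: "z \<in> uhp" for z
  proof -
    note DERIV_chain2[OF P'[OF qexp_in_ball[OF z]] has_field_derivative_qexp]
    from DERIV_diff[OF H[OF z] DERIV_cdivide[OF this, of "2 * of_real pi * \<i>"]]
    show ?thesis by (simp add: R_def hB[OF z] mult_ac)
  qed
  then obtain c where c: "\<And>z. z \<in> uhp \<Longrightarrow> R z = c"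
    using uhp_constant_if_derivative_zero[of R] by metis
  show ?thesis
  proof (rule that[of "\<lambda>q. c + P q / (2 * of_real pi * \<i>)"])
    have "P holomorphic_on ball 0 1"
      using P field_differentiable_def holomorphic_on_def by blast
    then show "(\<lambda>q. c + P q / (2 * of_real pi * \<i>)) holomorphic_on ball 0 1"
      by (intro holomorphic_intros) auto
    show "H z = c + P (qexp z) / (2 * of_real pi * \<i>)" if "z \<in> uhp" for z
      using c[OF that] by (simp add: R_def algebra_simps)
  qed
qed

lemma q_expansion_bounded:
  assumes G: "G holomorphic_on ball 0 1" and H: "\<And>z. z \<in> uhp \<Longrightarrow> H z = G (qexp z)"
  obtains K where "\<And>z. Im z \<ge> 1 \<Longrightarrow> norm (H z) \<le> K"
proof -
  \<comment> \<open>The radius is the value of |q| at height 1, so the region Im z \<ge> 1 maps into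
    a compact subset of the unit disc.\<close>
  let ?D = "cball (0::complex) (exp (- 2 * pi))"
  have "exp (- 2 * pi) < 1" by simp
  then have "?D \<subseteq> ball 0 1" by (simp add: cball_subset_ball_iff)
  then have "continuous_on ?D G"
    using G holomorphic_on_imp_continuous_on continuous_on_subset by blast
  then have "bounded (G ` ?D)" by (intro compact_imp_bounded compact_continuous_image compact_cball)
  then obtain K where K: "\<forall>q\<in>?D. norm (G q) \<le> K" unfolding bounded_iff by blast
  show ?thesis
  proof (rule that[of K])
    fix z assume z: "Im z \<ge> 1"
    then have "qexp z \<in> ?D" by (simp add: norm_qexp)
    moreover have "z \<in> uhp" using z by (simp add: uhp_def)
    ultimately show "norm (H z) \<le> K" using K H by simp
  qed
qed

subsection \<open>Second order forms and their derivatives\<close>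

lemma slash_0: "z \<in> uhp \<Longrightarrow> slash 0 f \<gamma> z = f (mob \<gamma> z)"
  by (simp add: slash_def on_uhp_def)

lemma slash_2: "z \<in> uhp \<Longrightarrow> slash 2 f \<gamma> z = f (mob \<gamma> z) / (aut_factor \<gamma> z)\<^sup>2"
  by (simp add: slash_def on_uhp_def power_int_minus divide_inverse)

lemma slash_outside: "z \<notin> uhp \<Longrightarrow> slash k f \<gamma> z = 0"
  by (simp add: slash_def on_uhp_def)

text \<open>Differentiation turns the weight 0 action into the weight 2 action. The lemma is stated
  for all of \<open>PSL2R\<close> because it serves both the elements of \<Gamma> and the scaling
  matrices.\<close>

lemma has_field_derivative_compose_mob:
  assumes "F holomorphic_on uhp" "\<gamma> \<in> carrier PSL2R" "z \<in> uhp"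
  shows "((\<lambda>z. F (mob \<gamma> z)) has_field_derivative slash 2 (on_uhp (deriv F)) \<gamma> z) (at z)"
proof -
  note m = mob_in_uhp[OF assms(2,3)]
  note DERIV_chain2[OF holomorphic_derivI[OF assms(1) open_uhp m] mob_has_field_derivative[OF assms(2,3)]]
  then show ?thesis using m by (simp add: slash_2[OF assms(3)] on_uhp_def)
qed

lemma holomorphic_compose_mob:
  assumes "F holomorphic_on uhp" "\<gamma> \<in> carrier PSL2R"
  shows "(\<lambda>z. F (mob \<gamma> z)) holomorphic_on uhp"
  using has_field_derivative_compose_mob[OF assms]
  by (meson field_differentiable_at_within field_differentiable_def holomorphic_onI)

section \<open>The half plane with cusps adjoined\<close>

lemma boundary_circle_disjoint_uhp: "z \<in> uhp \<Longrightarrow> Fin z \<notin> boundary_circle"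
  by (auto simp: boundary_circle_def uhp_def)

lemma mob_sphere_Infty_boundary: "mob_sphere \<rho> Infty \<in> boundary_circle"
  by (auto simp: boundary_circle_def simp flip: of_real_divide)

lemma topspace_extended_uhp_topology:
  "topspace (extended_uhp_topology \<Gamma>) = extended_uhp \<Gamma>"
proof
  show "topspace (extended_uhp_topology \<Gamma>) \<subseteq> extended_uhp \<Gamma>"
    using openin_topspace[of "extended_uhp_topology \<Gamma>"] unfolding openin_extended_uhp_topology by blast
  have "{z \<in> uhp. Fin z \<in> extended_uhp \<Gamma>} = uhp" by (auto simp: extended_uhp_def)
  moreover have "\<exists>Y>0. \<forall>z. Im z > Y \<longrightarrow> mob_sphere \<rho> (Fin z) \<in> extended_uhp \<Gamma>"
    if "\<rho> \<in> carrier PSL2R" for \<rho>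
    using that by (intro exI[of _ 1])
      (auto simp: extended_uhp_def mob_sphere_Fin_uhp mob_in_uhp uhp_def simp del: mob_sphere.simps
        intro!: imageI mob_in_uhp[unfolded uhp_def, simplified])
  ultimately have "openin (extended_uhp_topology \<Gamma>) (extended_uhp \<Gamma>)"
    unfolding openin_extended_uhp_topology using open_uhp by (simp del: mob_sphere.simps)
  then show "extended_uhp \<Gamma> \<subseteq> topspace (extended_uhp_topology \<Gamma>)" by (rule openin_subset)
qed

section \<open>A Fuchsian group with scaled cusps\<close>

locale cusped_fuchsian =
  fixes \<Gamma> :: "(real^2^2) set set"
    and C :: "rsphere set"
    and \<sigma> :: "rsphere \<Rightarrow> (real^2^2) set"
  assumes first_kind: "fuchsian_first_kind \<Gamma>"
    and reps: "cusp_representatives \<Gamma> C"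
    and scaling: "scaling_matrices \<Gamma> C \<sigma>"
begin

lemma subgroup_\<Gamma>: "subgroup \<Gamma> PSL2R"
  using first_kind by (simp add: fuchsian_first_kind_def fuchsian_def)

lemma \<Gamma>_carrier: "\<gamma> \<in> \<Gamma> \<Longrightarrow> \<gamma> \<in> carrier PSL2R"
  using subgroup_\<Gamma> by (rule subgroup.mem_carrier)

lemma \<Gamma>_inv: "\<gamma> \<in> \<Gamma> \<Longrightarrow> inv\<^bsub>PSL2R\<^esub> \<gamma> \<in> \<Gamma>"
  using subgroup_\<Gamma> by (rule subgroup.m_inv_closed)

lemma \<Gamma>_mult: "\<gamma> \<in> \<Gamma> \<Longrightarrow> \<delta> \<in> \<Gamma> \<Longrightarrow> \<gamma> \<otimes>\<^bsub>PSL2R\<^esub> \<delta> \<in> \<Gamma>"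
  using subgroup_\<Gamma> by (rule subgroup.m_closed)

lemma \<sigma>_carrier: "\<aa> \<in> C \<Longrightarrow> \<sigma> \<aa> \<in> carrier PSL2R"
  and \<sigma>_Infty: "\<aa> \<in> C \<Longrightarrow> mob_sphere (\<sigma> \<aa>) Infty = \<aa>"
  and \<sigma>_stabilizer: "\<aa> \<in> C \<Longrightarrow>
    (\<lambda>\<gamma>. inv\<^bsub>PSL2R\<^esub> (\<sigma> \<aa>) \<otimes>\<^bsub>PSL2R\<^esub> \<gamma> \<otimes>\<^bsub>PSL2R\<^esub> \<sigma> \<aa>) ` stabilizer_in \<Gamma> \<aa>
      = range (\<lambda>n. psl (translation_matrix n))"
  using scaling unfolding scaling_matrices_def by blast+

lemma cusp_orbit:
  assumes "s \<in> cusps \<Gamma>"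
  obtains \<aa> \<gamma> where "\<aa> \<in> C" "\<gamma> \<in> \<Gamma>" "mob_sphere \<gamma> \<aa> = s"
  using reps assms unfolding cusp_representatives_def by blast

lemma mob_conjugate_translation:
  assumes "\<aa> \<in> C" "\<pi> \<in> carrier PSL2R" "z \<in> uhp"
    and "inv\<^bsub>PSL2R\<^esub> (\<sigma> \<aa>) \<otimes>\<^bsub>PSL2R\<^esub> \<pi> \<otimes>\<^bsub>PSL2R\<^esub> \<sigma> \<aa> = psl (translation_matrix n)"
  shows "mob \<pi> (mob (\<sigma> \<aa>) z) = mob (\<sigma> \<aa>) (z + of_int n)"
proof -
  interpret group PSL2R by (rule group_PSL2R)
  note s = \<sigma>_carrier[OF assms(1)]
  have "z + of_int n = mob (inv\<^bsub>PSL2R\<^esub> (\<sigma> \<aa>)) (mob \<pi> (mob (\<sigma> \<aa>) z))"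
    unfolding mob_translation[symmetric] assms(4)[symmetric]
    using s assms(2,3) by (simp add: mob_mult mob_in_uhp)
  then show ?thesis using s assms by (simp add: mob_inv mob_in_uhp)
qed

text \<open>The preimage of the unit translation in the stabilizer of the cusp. That it is parabolic
  lets parabolic invariance of F become period 1 of F \<circ> \<sigma>.\<close>

lemma cusp_translation:
  assumes "\<aa> \<in> C"
  obtains \<pi> where "\<pi> \<in> \<Gamma>" "parabolic \<pi>"
    "\<And>z. z \<in> uhp \<Longrightarrow> mob \<pi> (mob (\<sigma> \<aa>) z) = mob (\<sigma> \<aa>) (z + 1)"
proof -
  have "psl (translation_matrix 1) \<in> range (\<lambda>n. psl (translation_matrix n))" by blast
  then obtain \<pi> where \<pi>: "\<pi> \<in> \<Gamma>"
    "inv\<^bsub>PSL2R\<^esub> (\<sigma> \<aa>) \<otimes>\<^bsub>PSL2R\<^esub> \<pi> \<otimes>\<^bsub>PSL2R\<^esub> \<sigma> \<aa> = psl (translation_matrix 1)"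
    unfolding \<sigma>_stabilizer[OF assms, symmetric] by (auto simp: stabilizer_in_def)
  show ?thesis
    using that[OF \<pi>(1) parabolic_conjugate_translation[OF \<sigma>_carrier[OF assms] \<Gamma>_carrier[OF \<pi>(1)] \<pi>(2)]]
      mob_conjugate_translation[OF assms \<Gamma>_carrier[OF \<pi>(1)] _ \<pi>(2)] by simp
qed

text \<open>The fixed point of \<pi> is a cusp, say \<gamma>\<aa> with \<aa> a representative. Then
  \<gamma>^-1 \<pi> \<gamma> stabilizes \<aa>, and \<sigma> conjugates it to an integral
  translation. This lets a parabolic period be read off from an expansion in q at a
  representative.\<close>

lemma parabolic_acts_as_translation:
  assumes "\<pi> \<in> \<Gamma>" "parabolic \<pi>"
  obtains \<aa> \<gamma> n where "\<aa> \<in> C" "\<gamma> \<in> \<Gamma>"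
    "\<And>z. z \<in> uhp \<Longrightarrow> mob \<pi> (mob \<gamma> (mob (\<sigma> \<aa>) z)) = mob \<gamma> (mob (\<sigma> \<aa>) (z + of_int n))"
proof -
  obtain s where s: "s \<in> boundary_circle" "mob_sphere \<pi> s = s"
    using parabolic_fixes_boundary_point[OF assms(2)] .
  then have "s \<in> cusps \<Gamma>" using assms by (auto simp: cusps_def)
  then obtain \<aa> \<gamma> where a: "\<aa> \<in> C" "\<gamma> \<in> \<Gamma>" "mob_sphere \<gamma> \<aa> = s" by (rule cusp_orbit)
  define \<delta> where "\<delta> = inv\<^bsub>PSL2R\<^esub> \<gamma> \<otimes>\<^bsub>PSL2R\<^esub> (\<pi> \<otimes>\<^bsub>PSL2R\<^esub> \<gamma>)"
  have \<delta>: "\<delta> \<in> \<Gamma>" unfolding \<delta>_def using a assms by (intro \<Gamma>_mult \<Gamma>_inv)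
  have "mob_sphere \<delta> \<aa> = mob_sphere (inv\<^bsub>PSL2R\<^esub> \<gamma>) (mob_sphere \<pi> (mob_sphere \<gamma> \<aa>))"
    unfolding \<delta>_def using a assms
    by (simp add: mob_sphere_mult \<Gamma>_carrier \<Gamma>_inv \<Gamma>_mult del: mob_sphere.simps)
  also have "\<dots> = \<aa>" using s(2) a(3) mob_sphere_inv(1)[OF \<Gamma>_carrier[OF a(2)]] by metis
  finally have "\<delta> \<in> stabilizer_in \<Gamma> \<aa>" using \<delta> by (simp add: stabilizer_in_def)
  then obtain n where n:
    "inv\<^bsub>PSL2R\<^esub> (\<sigma> \<aa>) \<otimes>\<^bsub>PSL2R\<^esub> \<delta> \<otimes>\<^bsub>PSL2R\<^esub> \<sigma> \<aa> = psl (translation_matrix n)"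
    using \<sigma>_stabilizer[OF a(1)] by blast
  show ?thesis
  proof (rule that[OF a(1,2)])
    fix z assume z: "z \<in> uhp"
    let ?w = "mob (\<sigma> \<aa>) z"
    have w: "?w \<in> uhp" using z a \<sigma>_carrier mob_in_uhp by blast
    have "mob \<delta> ?w = mob (inv\<^bsub>PSL2R\<^esub> \<gamma>) (mob \<pi> (mob \<gamma> ?w))"
      unfolding \<delta>_def using a assms w by (simp add: mob_mult \<Gamma>_carrier \<Gamma>_inv \<Gamma>_mult mob_in_uhp)
    then have "mob \<gamma> (mob \<delta> ?w) = mob \<pi> (mob \<gamma> ?w)"
      using a assms w by (simp add: mob_inv \<Gamma>_carrier mob_in_uhp)
    then show "mob \<pi> (mob \<gamma> ?w) = mob \<gamma> (mob (\<sigma> \<aa>) (z + of_int n))"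
      using mob_conjugate_translation[OF a(1) \<Gamma>_carrier[OF \<delta>] z n] by simp
  qed
qed

text \<open>Only parabolic invariance is assumed, so that the lemma applies to second order forms as
  well as to the invariant functions in \<open>M0\<close>.\<close>

lemma cusp_q_expansion:
  assumes "F holomorphic_on uhp" "moderate_growth C \<sigma> F" "\<aa> \<in> C"
    and inv: "\<And>\<pi> z. \<pi> \<in> \<Gamma> \<Longrightarrow> parabolic \<pi> \<Longrightarrow> z \<in> uhp \<Longrightarrow> F (mob \<pi> z) = F z"
  obtains G where "G holomorphic_on ball 0 1" "\<And>z. z \<in> uhp \<Longrightarrow> F (mob (\<sigma> \<aa>) z) = G (qexp z)"
proof -
  note s = \<sigma>_carrier[OF assms(3)]
  obtain \<pi> where \<pi>: "\<pi> \<in> \<Gamma>" "parabolic \<pi>"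
    "\<And>z. z \<in> uhp \<Longrightarrow> mob \<pi> (mob (\<sigma> \<aa>) z) = mob (\<sigma> \<aa>) (z + 1)"
    using cusp_translation[OF assms(3)] by blast
  have "F (mob (\<sigma> \<aa>) (z + 1)) = F (mob (\<sigma> \<aa>) z)" if "z \<in> uhp" for z
    using inv[OF \<pi>(1,2) mob_in_uhp[OF s that]] \<pi>(3)[OF that] by simp
  moreover obtain c K Y where "\<And>z. Im z \<ge> Y \<Longrightarrow> norm (F (mob (\<sigma> \<aa>) z)) \<le> K * Im z powr c"
    using assms(2,3) unfolding moderate_growth_def by blast
  ultimately show ?thesis
    using periodic_moderate_q_expansion[OF holomorphic_compose_mob[OF assms(1) s]] that by blast
qed

section \<open>The maximum principle on the compactified quotient\<close>

lemma M0_constant: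
  assumes "h \<in> M0 \<Gamma> C \<sigma>"
  obtains c where "\<And>z. z \<in> uhp \<Longrightarrow> h z = c"
proof (rule ccontr)
  assume "\<not> thesis"
  then have nc: "\<not> h constant_on uhp" using that unfolding constant_on_def by blast
  have hol: "h holomorphic_on uhp" and growth: "moderate_growth C \<sigma> h"
    using assms by (auto simp: M0_def)
  have inv: "h (mob \<gamma> z) = h z" if "\<gamma> \<in> \<Gamma>" "z \<in> uhp" for \<gamma> z
    using assms that slash_0[OF that(2), of h \<gamma>] by (simp add: M0_def)
  \<comment> \<open>A sublevel set in the extended half plane. Quantifying over all \<open>\<rho>\<close> with \<open>\<rho>\<infinity> = s\<close> makes it open by
    construction. If \<open>h\<close> is not constant, no point maximises \<open>|h|\<close>, so these sets cover; but a
    finite family of them misses the point at which \<open>|h|\<close> is largest among its indices.\<close>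
  define U where "U w = Fin ` {z \<in> uhp. norm (h z) < norm (h w)} \<union>
      {s \<in> cusps \<Gamma>. \<forall>\<rho>\<in>carrier PSL2R. mob_sphere \<rho> Infty = s \<longrightarrow>
         (\<exists>Y>0. \<forall>z. Im z > Y \<longrightarrow> norm (h (mob \<rho> z)) < norm (h w))}" for w
  have cusp_not_uhp: "Fin z \<notin> cusps \<Gamma>" if "z \<in> uhp" for z
    using boundary_circle_disjoint_uhp[OF that] by (auto simp: cusps_def)
  have U_ext: "U w \<subseteq> extended_uhp \<Gamma>" for w
    by (auto simp: U_def extended_uhp_def)
  have U_Fin: "Fin z \<in> U w \<longleftrightarrow> norm (h z) < norm (h w)" if "z \<in> uhp" for z w
    using cusp_not_uhp[OF that] that by (auto simp: U_def)
  have U_cusp: "mob_sphere \<rho> Infty \<in> U w \<longleftrightarrow> mob_sphere \<rho> Infty \<in> cusps \<Gamma> \<and>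
      (\<forall>\<rho>'\<in>carrier PSL2R. mob_sphere \<rho>' Infty = mob_sphere \<rho> Infty \<longrightarrow>
         (\<exists>Y>0. \<forall>z. Im z > Y \<longrightarrow> norm (h (mob \<rho>' z)) < norm (h w)))" for \<rho> w
  proof -
    have "mob_sphere \<rho> Infty \<notin> Fin ` uhp"
      using mob_sphere_Infty_boundary[of \<rho>] boundary_circle_disjoint_uhp by (metis imageE)
    then show ?thesis unfolding U_def by blast
  qed
  have U_open: "openin (extended_uhp_topology \<Gamma>) (U w)" for w
    unfolding openin_extended_uhp_topology
  proof (intro conjI U_ext ballI impI)
    have "{z \<in> uhp. Fin z \<in> U w} = uhp \<inter> (\<lambda>z. norm (h z)) -` {..<norm (h w)}" using U_Fin by auto
    moreover have "continuous_on uhp (\<lambda>z. norm (h z))"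
      using hol by (intro continuous_on_norm holomorphic_on_imp_continuous_on)
    ultimately show "open {z \<in> uhp. Fin z \<in> U w}"
      using continuous_open_preimage[OF _ open_uhp open_lessThan] by metis
  next
    fix \<rho> assume \<rho>: "\<rho> \<in> carrier PSL2R" "mob_sphere \<rho> Infty \<in> U w"
    then obtain Y where Y: "Y > 0" "\<forall>z. Im z > Y \<longrightarrow> norm (h (mob \<rho> z)) < norm (h w)"
      using U_cusp[of \<rho> w] by blast
    have "mob_sphere \<rho> (Fin z) \<in> U w" if z: "Im z > Y" for z
    proof -
      have "z \<in> uhp" using z Y by (simp add: uhp_def)
      then show ?thesis using \<rho>(1) Y(2) z mob_sphere_Fin_uhp mob_in_uhp U_Fin by metis
    qed
    then show "\<exists>Y>0. \<forall>z. Im z > Y \<longrightarrow> mob_sphere \<rho> (Fin z) \<in> U w" using Y(1) by blast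
  qed
  have U_inv: "mob_sphere \<gamma> y \<in> U w"
    if y: "y \<in> U w" and \<gamma>: "\<gamma> \<in> \<Gamma>" and ext: "mob_sphere \<gamma> y \<in> extended_uhp \<Gamma>" for y \<gamma> w
  proof -
    note g = \<Gamma>_carrier[OF \<gamma>]
    from y consider z where "z \<in> uhp" "y = Fin z" "norm (h z) < norm (h w)"
      | "y \<in> cusps \<Gamma>" "\<And>\<rho>. \<rho> \<in> carrier PSL2R \<Longrightarrow> mob_sphere \<rho> Infty = y \<Longrightarrow>
         \<exists>Y>0. \<forall>z. Im z > Y \<longrightarrow> norm (h (mob \<rho> z)) < norm (h w)"
      unfolding U_def by blast
    then show ?thesis
    proof cases
      case 1
      then show ?thesis using inv[OF \<gamma>] mob_sphere_Fin_uhp[OF g] mob_in_uhp[OF g] U_Fin by metis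
    next
      case 2
      \<comment> \<open>An interior image would be carried back to an interior point by the inverse
        of \<gamma>, whereas cusps lie on the boundary circle. With \<open>ext\<close> the image
        must then be a cusp.\<close>
      have "mob_sphere \<gamma> y \<noteq> Fin z" if "z \<in> uhp" for z
      proof
        assume "mob_sphere \<gamma> y = Fin z"
        then have "y = mob_sphere (inv\<^bsub>PSL2R\<^esub> \<gamma>) (Fin z)" using mob_sphere_inv(1)[OF g] by metis
        also have "\<dots> = Fin (mob (inv\<^bsub>PSL2R\<^esub> \<gamma>) z)"
          using mob_sphere_Fin_uhp[OF \<Gamma>_carrier[OF \<Gamma>_inv[OF \<gamma>]] that] .
        finally show False
          using 2(1) cusp_not_uhp[OF mob_in_uhp[OF \<Gamma>_carrier[OF \<Gamma>_inv[OF \<gamma>]] that]] by simp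
      qed
      then have cusp: "mob_sphere \<gamma> y \<in> cusps \<Gamma>" using ext by (auto simp: extended_uhp_def)
      \<comment> \<open>A horoball map \<rho> at the image cusp becomes one at \<open>y\<close>
        after composing with the inverse of \<gamma>, and \<Gamma>-invariance leaves the values of
        \<open>h\<close> unchanged.\<close>
      have "\<exists>Y>0. \<forall>z. Im z > Y \<longrightarrow> norm (h (mob \<rho> z)) < norm (h w)"
        if \<rho>: "\<rho> \<in> carrier PSL2R" "mob_sphere \<rho> Infty = mob_sphere \<gamma> y" for \<rho>
      proof -
        let ?i = "inv\<^bsub>PSL2R\<^esub> \<gamma>"
        have i: "?i \<in> \<Gamma>" "?i \<in> carrier PSL2R" using \<gamma> \<Gamma>_inv \<Gamma>_carrier by blast+
        have "mob_sphere (?i \<otimes>\<^bsub>PSL2R\<^esub> \<rho>) Infty = y"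
          using mob_sphere_mult[OF i(2) \<rho>(1)] \<rho>(2) mob_sphere_inv(1)[OF g] by metis
        moreover have "?i \<otimes>\<^bsub>PSL2R\<^esub> \<rho> \<in> carrier PSL2R"
          using i \<rho> group_PSL2R by (simp add: group.is_monoid monoid.m_closed)
        ultimately obtain Y where Y: "Y > 0"
          "\<forall>z. Im z > Y \<longrightarrow> norm (h (mob (?i \<otimes>\<^bsub>PSL2R\<^esub> \<rho>) z)) < norm (h w)"
          using 2(2) by blast
        have "norm (h (mob \<rho> z)) < norm (h w)" if "Im z > Y" for z
        proof -
          have z: "z \<in> uhp" using that Y by (simp add: uhp_def)
          then have "h (mob (?i \<otimes>\<^bsub>PSL2R\<^esub> \<rho>) z) = h (mob \<rho> z)"
            using mob_mult[OF i(2) \<rho>(1)] inv[OF i(1) mob_in_uhp[OF \<rho>(1) z]] by simp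
          then show ?thesis using Y(2) that by metis
        qed
        then show ?thesis using Y(1) by blast
      qed
      then show ?thesis using cusp unfolding U_def by blast
    qed
  qed
  have cover: "\<exists>w\<in>uhp. p \<in> U w" if p: "p \<in> extended_uhp \<Gamma>" for p
  proof -
    from p consider z where "z \<in> uhp" "p = Fin z" | "p \<in> cusps \<Gamma>"
      by (auto simp: extended_uhp_def)
    then show ?thesis
    proof cases
      case 1
      have "\<exists>w\<in>uhp. norm (h z) < norm (h w)"
      proof (rule ccontr)
        assume "\<not> ?thesis"
        then have "norm (h w) \<le> norm (h z)" if "w \<in> uhp" for w using that by force
        then have "h constant_on uhp"
          using maximum_modulus_principle[OF hol open_uhp convex_connected[OF convex_uhp] open_uhp] 1(1)
          by blast
        then show False using nc by blast
      qed
      then show ?thesis using 1 U_Fin by blast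
    next
      case 2
      then obtain \<aa> \<gamma> where a: "\<aa> \<in> C" "\<gamma> \<in> \<Gamma>" "mob_sphere \<gamma> \<aa> = p" by (rule cusp_orbit)
      note s = \<sigma>_carrier[OF a(1)] and g = \<Gamma>_carrier[OF a(2)]
      obtain G where G: "G holomorphic_on ball 0 1"
        "\<And>z. z \<in> uhp \<Longrightarrow> h (mob (\<sigma> \<aa>) z) = G (qexp z)"
        using cusp_q_expansion[OF hol growth a(1)] inv by blast
      \<comment> \<open>\<open>G 0\<close> plays the role of the value of \<open>h\<close> at the
        cusp. If it dominated all values of \<open>h\<close>, then \<open>G\<close> would attain its
        maximum modulus at the centre of the disc, so \<open>G\<close> and with it \<open>h\<close>
        would be constant.\<close>
      have "\<exists>w\<in>uhp. norm (G 0) < norm (h w)"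
      proof (rule ccontr)
        assume "\<not> ?thesis"
        then have le: "norm (h w) \<le> norm (G 0)" if "w \<in> uhp" for w using that by force
        have "norm (G q) \<le> norm (G 0)" if q: "q \<in> ball 0 1" for q
        proof (cases "q = 0")
          case False
          then obtain z where "z \<in> uhp" "qexp z = q" using q qexp_surj[of q] by auto
          then show ?thesis using G(2) le mob_in_uhp[OF s] by metis
        qed simp
        then have "G constant_on ball 0 1"
          using maximum_modulus_principle[OF G(1) open_ball connected_ball open_ball order_refl, of 0] by simp
        then obtain c where c: "\<And>q. q \<in> ball 0 1 \<Longrightarrow> G q = c" unfolding constant_on_def by blast
        have "h w = c" if w: "w \<in> uhp" for w
        proof -
          let ?z = "mob (inv\<^bsub>PSL2R\<^esub> (\<sigma> \<aa>)) w"
          have "?z \<in> uhp" using s w by (simp add: mob_in_uhp group.inv_closed group_PSL2R)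
          then show ?thesis using G(2) c qexp_in_ball mob_inv(2)[OF s w] by metis
        qed
        then show False using nc unfolding constant_on_def by blast
      qed
      then obtain w where w: "w \<in> uhp" "norm (G 0) < norm (h w)" by blast
      have "isCont G 0"
        using G(1) holomorphic_on_imp_continuous_on continuous_on_eq_continuous_at[OF open_ball] by force
      then have "isCont (\<lambda>q. norm (G q)) 0" by (intro continuous_intros)
      then have "eventually (\<lambda>q. norm (G q) < norm (h w)) (at 0)"
        using w(2) unfolding isCont_def by (rule order_tendstoD)
      then obtain d where d: "d > 0" "\<And>q. q \<noteq> 0 \<Longrightarrow> norm q < d \<Longrightarrow> norm (G q) < norm (h w)"
        by (auto simp: eventually_at dist_norm)
      \<comment> \<open>The height at which |q| equals \<open>d\<close>.\<close>
      define Y0 where "Y0 = - ln d / (2 * pi)"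
      have near: "norm (h (mob (\<sigma> \<aa>) z)) < norm (h w)" if z: "z \<in> uhp" "Im z > Y0" for z
      proof -
        have "- 2 * pi * Im z < ln d" using z(2) by (simp add: Y0_def field_simps)
        then have "exp (- 2 * pi * Im z) < d" using d(1) by (metis exp_less_cancel_iff exp_ln)
        then have "norm (qexp z) < d" by (simp add: norm_qexp)
        then show ?thesis using d(2)[of "qexp z"] G(2)[OF z(1)] by simp
      qed
      have "\<exists>Y>0. \<forall>z. Im z > Y \<longrightarrow> norm (h (mob \<rho> z)) < norm (h w)"
        if \<rho>: "\<rho> \<in> carrier PSL2R" "mob_sphere \<rho> Infty = p" for \<rho>
      proof -
        interpret group PSL2R by (rule group_PSL2R)
        let ?gs = "\<gamma> \<otimes>\<^bsub>PSL2R\<^esub> \<sigma> \<aa>"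
        have gs: "?gs \<in> carrier PSL2R" using g s by simp
        \<comment> \<open>\<tau> compares the given \<rho> with the known map \<gamma>\<sigma> to
          the same cusp. It fixes \<infinity> and multiplies heights by some m > 0, so the threshold
          \<open>Y0\<close> becomes \<open>Y0 / m\<close>; the maximum with 1 keeps it positive,
          since \<open>Y0\<close> may be negative.\<close>
        define \<tau> where "\<tau> = inv\<^bsub>PSL2R\<^esub> ?gs \<otimes>\<^bsub>PSL2R\<^esub> \<rho>"
        have \<tau>: "\<tau> \<in> carrier PSL2R" using gs \<rho>(1) by (simp add: \<tau>_def)
        have "mob_sphere ?gs Infty = p"
          using mob_sphere_mult[OF g s] \<sigma>_Infty[OF a(1)] a(3) by metis
        then have "mob_sphere \<tau> Infty = Infty"
          unfolding \<tau>_def using mob_sphere_mult[OF inv_closed[OF gs] \<rho>(1)] \<rho>(2) mob_sphere_inv(1)[OF gs]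
          by metis
        then obtain m where m: "m > 0" "\<And>z. Im (mob \<tau> z) = m * Im z"
          using mob_stabilizer_Infty[OF \<tau>] by blast
        have \<rho>_eq: "\<rho> = \<gamma> \<otimes>\<^bsub>PSL2R\<^esub> (\<sigma> \<aa> \<otimes>\<^bsub>PSL2R\<^esub> \<tau>)"
          unfolding \<tau>_def using g s gs \<rho>(1) by (simp add: m_assoc[symmetric])
        have "norm (h (mob \<rho> z)) < norm (h w)" if z: "Im z > max 1 (Y0 / m)" for z
        proof -
          have zu: "z \<in> uhp" using z by (simp add: uhp_def)
          have "Im (mob \<tau> z) > Y0" using z m by (simp add: field_simps)
          moreover have tz: "mob \<tau> z \<in> uhp" using mob_in_uhp[OF \<tau> zu] .
          moreover have "mob \<rho> z = mob \<gamma> (mob (\<sigma> \<aa>) (mob \<tau> z))"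
            unfolding \<rho>_eq using g s \<tau> zu by (simp add: mob_mult)
          ultimately show ?thesis
            using near inv[OF a(2) mob_in_uhp[OF s tz]] by simp
        qed
        then show ?thesis by (intro exI[of _ "max 1 (Y0 / m)"]) simp
      qed
      then have "p \<in> U w" using 2 unfolding U_def by blast
      then show ?thesis using w(1) by blast
    qed
  qed
  define q where "q = (\<lambda>x. (\<lambda>\<gamma>. mob_sphere \<gamma> x) ` \<Gamma>)"
  \<comment> \<open>\<open>U w\<close> is a union of fibres of \<open>q\<close> within the extended
    half plane, so its image in the quotient is open, and a cover of the quotient pulls back to a
    cover upstairs.\<close>
  have sat: "x \<in> U w" if x: "x \<in> extended_uhp \<Gamma>" and "q x \<in> q ` U w" for x w
  proof -
    obtain y where y: "y \<in> U w" "q x = q y" using \<open>q x \<in> q ` U w\<close> by blast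
    have "mob_sphere \<one>\<^bsub>PSL2R\<^esub> x \<in> q x"
      unfolding q_def using subgroup.one_closed[OF subgroup_\<Gamma>] by blast
    then have "x \<in> q y" using y(2) by (simp add: mob_sphere_one)
    then obtain \<gamma> where "\<gamma> \<in> \<Gamma>" "x = mob_sphere \<gamma> y" unfolding q_def by blast
    then show ?thesis using U_inv[OF y(1)] x by blast
  qed
  let ?X = "extended_uhp_topology \<Gamma>"
  have compact: "compact_space (quotient_topology ?X q)"
    using first_kind unfolding fuchsian_first_kind_def orbit_space_def q_def by blast
  have top: "topspace (quotient_topology ?X q) = q ` extended_uhp \<Gamma>"
    using quotient_imp_surjective_map[OF quotient_map_quotient_topology, of q ?X]
    by (simp add: topspace_extended_uhp_topology)
  have opn: "openin (quotient_topology ?X q) (q ` U w)" for w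
  proof -
    have "{x \<in> extended_uhp \<Gamma>. q x \<in> q ` U w} = U w" using sat U_ext by blast
    then show ?thesis
      unfolding openin_quotient_topology topspace_extended_uhp_topology
      using U_open[of w] U_ext[of w] by auto
  qed
  have cov: "topspace (quotient_topology ?X q) \<subseteq> \<Union> ((\<lambda>w. q ` U w) ` uhp)"
    unfolding top using cover by blast
  obtain \<F> where \<F>: "finite \<F>" "\<F> \<subseteq> (\<lambda>w. q ` U w) ` uhp" "q ` extended_uhp \<Gamma> \<subseteq> \<Union>\<F>"
    using compact[unfolded compact_space_alt, THEN spec, THEN mp, OF conjI[OF _ cov]] opn top by auto
  then obtain W where W: "finite W" "W \<subseteq> uhp" "\<F> = (\<lambda>w. q ` U w) ` W"
    using finite_subset_image by metis
  have WU: "\<exists>w\<in>W. x \<in> U w" if "x \<in> extended_uhp \<Gamma>" for x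
    using \<F>(3) W(3) sat[OF that] that by blast
  \<comment> \<open>Any point will do; it forces the finite index set to be nonempty, so that
    \<open>Max\<close> is meaningful.\<close>
  have "Fin \<i> \<in> extended_uhp \<Gamma>" by (simp add: extended_uhp_def uhp_def)
  then have "W \<noteq> {}" using WU by blast
  then have "Max ((\<lambda>w. norm (h w)) ` W) \<in> (\<lambda>w. norm (h w)) ` W" using W(1) by (intro Max_in) auto
  then obtain w0 where w0: "w0 \<in> W" and max: "Max ((\<lambda>w. norm (h w)) ` W) = norm (h w0)" by blast
  have w0_max: "norm (h w) \<le> norm (h w0)" if "w \<in> W" for w
    unfolding max[symmetric] using W(1) that by (intro Max_ge) auto
  have "Fin w0 \<in> extended_uhp \<Gamma>" using w0 W(2) by (auto simp: extended_uhp_def)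
  then obtain w where "w \<in> W" "Fin w0 \<in> U w" using WU by blast
  then show False using U_Fin[of w0 w] w0 w0_max[of w] W(2) by auto
qed

section \<open>Differentiating and integrating forms\<close>

lemma constant_in_M0: "on_uhp (\<lambda>z. c) \<in> M0 \<Gamma> C \<sigma>"
proof -
  have "on_uhp (\<lambda>z. c) holomorphic_on uhp"
    by (rule holomorphic_transform[of "\<lambda>z. c"]) (auto simp: on_uhp_def)
  moreover have "slash 0 (on_uhp (\<lambda>z. c)) \<gamma> = on_uhp (\<lambda>z. c)" if "\<gamma> \<in> \<Gamma>" for \<gamma>
    using mob_in_uhp[OF \<Gamma>_carrier[OF that]] by (auto simp: fun_eq_iff slash_def on_uhp_def)
  moreover have "moderate_growth C \<sigma> (on_uhp (\<lambda>z. c))"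
    unfolding moderate_growth_def
    by (intro ballI exI[of _ 0] exI[of _ "norm c"] exI[of _ 1]) (auto simp: on_uhp_def)
  ultimately show ?thesis by (simp add: M0_def uhp_functions_def on_uhp_def)
qed

text \<open>The two cusp form conditions have different sources: weight 2 comes from
  \<open>M0_constant\<close>, which makes F(\<gamma>z) - F(z) a constant that differentiation
  removes, while vanishing at the cusps comes from parabolic invariance together with
  growth.\<close>

lemma derivative_in_S2:
  assumes "F \<in> M0_second \<Gamma> C \<sigma>"
  shows "on_uhp (deriv F) \<in> S2 \<Gamma> C \<sigma>"
proof -
  let ?f = "on_uhp (deriv F)"
  have F: "F holomorphic_on uhp" "moderate_growth C \<sigma> F"
    "\<And>\<gamma>. \<gamma> \<in> \<Gamma> \<Longrightarrow> slash 0 F \<gamma> - F \<in> M0 \<Gamma> C \<sigma>"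
    "\<And>\<pi>. \<pi> \<in> \<Gamma> \<Longrightarrow> parabolic \<pi> \<Longrightarrow> slash 0 F \<pi> - F = 0"
    using assms by (auto simp: M0_second_def)
  have par: "F (mob \<pi> z) = F z" if "\<pi> \<in> \<Gamma>" "parabolic \<pi>" "z \<in> uhp" for \<pi> z
    using fun_cong[OF F(4)[OF that(1,2)], of z] by (simp add: slash_0[OF that(3)])
  have "deriv F holomorphic_on uhp" by (rule holomorphic_deriv[OF F(1) open_uhp])
  then have "?f holomorphic_on uhp"
    by (rule holomorphic_transform) (simp add: on_uhp_def)
  moreover have "slash 2 ?f \<gamma> = ?f" if \<gamma>: "\<gamma> \<in> \<Gamma>" for \<gamma>
  proof
    fix z
    show "slash 2 ?f \<gamma> z = ?f z"
    proof (cases "z \<in> uhp")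
      case True
      obtain c where c: "\<And>z. z \<in> uhp \<Longrightarrow> (slash 0 F \<gamma> - F) z = c"
        using M0_constant[OF F(3)[OF \<gamma>]] by blast
      have "((\<lambda>z. F z + c) has_field_derivative deriv F z) (at z)"
        using DERIV_add[OF holomorphic_derivI[OF F(1) open_uhp True] DERIV_const, of c] by simp
      then have "((\<lambda>z. F (mob \<gamma> z)) has_field_derivative deriv F z) (at z)"
        by (rule has_field_derivative_transform_within_open[OF _ open_uhp True])
          (use c in \<open>auto simp: slash_0 algebra_simps\<close>)
      from DERIV_unique[OF has_field_derivative_compose_mob[OF F(1) \<Gamma>_carrier[OF \<gamma>] True] this]
      show ?thesis using True by (simp add: on_uhp_def)
    qed (simp add: slash_outside on_uhp_def)
  qed
  moreover have "\<exists>b :: nat \<Rightarrow> complex. \<forall>z\<in>uhp.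
      (\<lambda>n. b n * exp (2 * of_real pi * \<i> * of_nat (Suc n) * z)) sums slash 2 ?f (\<sigma> \<aa>) z"
    if a: "\<aa> \<in> C" for \<aa>
  proof -
    obtain G where G: "G holomorphic_on ball 0 1" "\<And>z. z \<in> uhp \<Longrightarrow> F (mob (\<sigma> \<aa>) z) = G (qexp z)"
      using cusp_q_expansion[OF F(1,2) a] par by blast
    then obtain b where "\<And>z. z \<in> uhp \<Longrightarrow>
        (\<lambda>n. b n * exp (2 * of_real pi * \<i> * of_nat (Suc n) * z)) sums deriv (\<lambda>z. F (mob (\<sigma> \<aa>) z)) z"
      using q_expansion_of_derivative[of G "\<lambda>z. F (mob (\<sigma> \<aa>) z)"] by metis
    then show ?thesis
      using DERIV_imp_deriv[OF has_field_derivative_compose_mob[OF F(1) \<sigma>_carrier[OF a]]] by metis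
  qed
  ultimately show ?thesis by (simp add: S2_def uhp_functions_def on_uhp_def)
qed

text \<open>Constant periods alone could be nonzero on parabolic elements; the expansion in q
  excludes this. Growth comes out with exponent 0, as a function holomorphic in q at the cusp is
  bounded near it.\<close>

lemma primitive_in_M0_second:
  assumes "F \<in> uhp_functions" and F: "F holomorphic_on uhp" and S: "on_uhp (deriv F) \<in> S2 \<Gamma> C \<sigma>"
  shows "F \<in> M0_second \<Gamma> C \<sigma>"
proof -
  let ?f = "on_uhp (deriv F)"
  have period: "\<exists>c. \<forall>z\<in>uhp. F (mob \<gamma> z) - F z = c" if \<gamma>: "\<gamma> \<in> \<Gamma>" for \<gamma>
  proof -
    have "((\<lambda>z. F (mob \<gamma> z) - F z) has_field_derivative 0) (at z)" if z: "z \<in> uhp" for z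
    proof -
      have "slash 2 ?f \<gamma> z = deriv F z" using S \<gamma> z by (simp add: S2_def) (simp add: on_uhp_def)
      then show ?thesis
        using DERIV_diff[OF has_field_derivative_compose_mob[OF F \<Gamma>_carrier[OF \<gamma>] z]
            holomorphic_derivI[OF F open_uhp z]] by simp
    qed
    then show ?thesis using uhp_constant_if_derivative_zero[of "\<lambda>z. F (mob \<gamma> z) - F z"] by metis
  qed
  have cusp: "\<exists>G. G holomorphic_on ball 0 1 \<and> (\<forall>z\<in>uhp. F (mob (\<sigma> \<aa>) z) = G (qexp z))"
    if a: "\<aa> \<in> C" for \<aa>
  proof -
    obtain b where "\<And>z. z \<in> uhp \<Longrightarrow>
        (\<lambda>n. b n * exp (2 * of_real pi * \<i> * of_nat (Suc n) * z)) sums slash 2 ?f (\<sigma> \<aa>) z"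
      using S a unfolding S2_def by blast
    from q_expansion_of_primitive[OF this has_field_derivative_compose_mob[OF F \<sigma>_carrier[OF a]]]
    show ?thesis by metis
  qed
  have "slash 0 F \<gamma> - F \<in> M0 \<Gamma> C \<sigma>" if \<gamma>: "\<gamma> \<in> \<Gamma>" for \<gamma>
  proof -
    obtain c where "\<forall>z\<in>uhp. F (mob \<gamma> z) - F z = c" using period[OF \<gamma>] by blast
    then have "slash 0 F \<gamma> - F = on_uhp (\<lambda>z. c)"
      using assms(1) by (auto simp: fun_eq_iff slash_def on_uhp_def uhp_functions_def)
    then show ?thesis by (simp add: constant_in_M0)
  qed
  moreover have "slash 0 F \<pi> - F = 0" if \<pi>: "\<pi> \<in> \<Gamma>" "parabolic \<pi>" for \<pi>
  proof -
    obtain \<aa> \<gamma> n where a: "\<aa> \<in> C" "\<gamma> \<in> \<Gamma>"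
      "\<And>z. z \<in> uhp \<Longrightarrow> mob \<pi> (mob \<gamma> (mob (\<sigma> \<aa>) z)) = mob \<gamma> (mob (\<sigma> \<aa>) (z + of_int n))"
      using parabolic_acts_as_translation[OF \<pi>] by blast
    note s = \<sigma>_carrier[OF a(1)] and g = \<Gamma>_carrier[OF a(2)]
    obtain c where c: "\<forall>z\<in>uhp. F (mob \<gamma> z) - F z = c" using period[OF a(2)] by blast
    obtain c' where c': "\<forall>z\<in>uhp. F (mob \<pi> z) - F z = c'" using period[OF \<pi>(1)] by blast
    obtain G where G: "\<forall>z\<in>uhp. F (mob (\<sigma> \<aa>) z) = G (qexp z)" using cusp[OF a(1)] by blast
    \<comment> \<open>The period is constant, so one sample point decides it: \<i> and \<i> + n have
      the same q.\<close>
    have i: "\<i> \<in> uhp" "\<i> + of_int n \<in> uhp" by (simp_all add: uhp_def)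
    note m = mob_in_uhp[OF s i(1)] mob_in_uhp[OF s i(2)]
    have "F (mob \<pi> (mob \<gamma> (mob (\<sigma> \<aa>) \<i>))) = F (mob (\<sigma> \<aa>) (\<i> + of_int n)) + c"
      using a(3)[OF i(1)] c m(2) by (simp add: algebra_simps)
    also have "\<dots> = F (mob (\<sigma> \<aa>) \<i>) + c" using G i by (simp add: qexp_add_int)
    also have "\<dots> = F (mob \<gamma> (mob (\<sigma> \<aa>) \<i>))" using c m(1) by (simp add: algebra_simps)
    finally have "c' = 0" using c' mob_in_uhp[OF g m(1)] by force
    then show ?thesis
      using c' assms(1) by (auto simp: fun_eq_iff slash_def on_uhp_def uhp_functions_def)
  qed
  moreover have "moderate_growth C \<sigma> F"
    unfolding moderate_growth_def
  proof
    fix \<aa> assume "\<aa> \<in> C"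
    then obtain G where "G holomorphic_on ball 0 1" "\<forall>z\<in>uhp. F (mob (\<sigma> \<aa>) z) = G (qexp z)"
      using cusp by blast
    then obtain K where "\<And>z. Im z \<ge> 1 \<Longrightarrow> norm (F (mob (\<sigma> \<aa>) z)) \<le> K"
      using q_expansion_bounded[of G "\<lambda>z. F (mob (\<sigma> \<aa>) z)"] by metis
    then show "\<exists>c K Y. Y > 0 \<and> (\<forall>z. Im z \<ge> Y \<longrightarrow> norm (F (mob (\<sigma> \<aa>) z)) \<le> K * Im z powr c)"
      by (intro exI[of _ 0] exI[of _ K] exI[of _ 1]) auto
  qed
  ultimately show ?thesis using assms(1) F by (simp add: M0_second_def)
qed

text \<open>This removes the group from the remaining argument: a basis of second order forms is now
  a matter of derivatives and linear algebra.\<close>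

lemma M0_second_iff:
  "F \<in> M0_second \<Gamma> C \<sigma> \<longleftrightarrow>
     F \<in> uhp_functions \<and> F holomorphic_on uhp \<and> on_uhp (deriv F) \<in> S2 \<Gamma> C \<sigma>"
  using derivative_in_S2 primitive_in_M0_second by (auto simp: M0_second_def)

end

subsection \<open>Bases\<close>

lemma sum_fscale_apply: "(\<Sum>i\<in>I. fscale (u i) (F i)) z = (\<Sum>i\<in>I. u i * F i z)"
  by (induction I rule: infinite_finite_induct) (auto simp: fscale_def)

text \<open>Injectivity plus independence of the image is independence of the indexed family. In
  coefficient form a linear relation can be carried from one family to another by
  differentiation.\<close>

lemma inj_independent_image_iff:
  assumes "finite I"
  shows "inj_on F I \<and> fun_space.independent (F ` I) \<longleftrightarrow>
    (\<forall>u. (\<Sum>i\<in>I. fscale (u i) (F i)) = 0 \<longrightarrow> (\<forall>i\<in>I. u i = 0))"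
proof (intro iffI conjI allI impI ballI)
  fix u i
  assume F: "inj_on F I \<and> fun_space.independent (F ` I)" and "i \<in> I"
    and 0: "(\<Sum>i\<in>I. fscale (u i) (F i)) = 0"
  have "(\<Sum>v\<in>F ` I. fscale (u (the_inv_into I F v)) v) = (\<Sum>i\<in>I. fscale (u i) (F i))"
    using F by (subst sum.reindex) (auto intro!: sum.cong simp: the_inv_into_f_f)
  then have "u (the_inv_into I F (F i)) = 0"
    using fun_space.independentD[of "F ` I" "F ` I" "\<lambda>v. u (the_inv_into I F v)" "F i"] F 0 assms \<open>i \<in> I\<close>
    by simp
  then show "u i = 0" using F \<open>i \<in> I\<close> by (simp add: the_inv_into_f_f)
next
  assume *: "\<forall>u. (\<Sum>i\<in>I. fscale (u i) (F i)) = 0 \<longrightarrow> (\<forall>i\<in>I. u i = 0)"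
  show inj: "inj_on F I"
  proof (rule inj_onI, rule ccontr)
    fix i j assume ij: "i \<in> I" "j \<in> I" "F i = F j" "i \<noteq> j"
    \<comment> \<open>A repeated vector yields the nontrivial relation F i - F j = 0.\<close>
    define u where "u k = (if k = i then 1 else if k = j then - 1 else 0 :: complex)" for k
    have "(\<Sum>k\<in>I. fscale (u k) (F k)) = (\<Sum>k\<in>{i, j}. fscale (u k) (F k))"
      using ij assms by (intro sum.mono_neutral_right) (auto simp: u_def fscale_def fun_eq_iff)
    also have "\<dots> = 0" using ij by (auto simp: u_def fscale_def fun_eq_iff)
    finally have "u i = 0" using * ij(1) by blast
    then show False by (simp add: u_def)
  qed
  show "fun_space.independent (F ` I)"
  proof (rule fun_space.independent_if_scalars_zero)
    fix u v assume 0: "(\<Sum>x\<in>F ` I. fscale (u x) x) = 0" and "v \<in> F ` I"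
    have "(\<Sum>i\<in>I. fscale (u (F i)) (F i)) = 0" using 0 inj by (simp add: sum.reindex)
    then have "\<forall>i\<in>I. u (F i) = 0" by (rule *[rule_format, THEN ballI])
    then show "u v = 0" using \<open>v \<in> F ` I\<close> by auto
  qed (use assms in simp)
qed

text \<open>Convexity provides a primitive P and keeps the segment inside the half plane, so the
  integral is P z - P z0. The cut-off by \<open>on_uhp\<close> does not affect the derivative
  because the half plane is open.\<close>

lemma contour_integral_linepath_derivative:
  assumes "f holomorphic_on uhp" "z0 \<in> uhp" "z \<in> uhp"
  shows "(on_uhp (\<lambda>z. contour_integral (linepath z0 z) f) has_field_derivative f z) (at z)"
proof -
  obtain P where P: "\<And>z. z \<in> uhp \<Longrightarrow> (P has_field_derivative f z) (at z within uhp)"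
    using holomorphic_convex_primitive'[OF convex_uhp open_uhp assms(1)] by blast
  have eq: "on_uhp (\<lambda>z. contour_integral (linepath z0 z) f) w = P w - P z0" if w: "w \<in> uhp" for w
  proof -
    have "path_image (linepath z0 w) \<subseteq> uhp"
      using closed_segment_subset[OF assms(2) w convex_uhp] by simp
    from contour_integral_primitive[OF P valid_path_linepath this]
    show ?thesis using w by (simp add: contour_integral_unique on_uhp_def)
  qed
  have "(P has_field_derivative f z) (at z)"
    using P[OF assms(3)] at_within_open[OF assms(3) open_uhp] by simp
  then have "((\<lambda>w. P w - P z0) has_field_derivative f z) (at z)"
    using DERIV_diff[OF _ DERIV_const, of P "f z" z UNIV "P z0"] by simp
  then show ?thesis
    by (rule has_field_derivative_transform_within_open[OF _ open_uhp assms(3)]) (simp add: eq)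
qed

theorem theorem6p3:
  fixes \<Gamma> :: "(real^2^2) set set"
    and C :: "rsphere set"
    and \<sigma> :: "rsphere \<Rightarrow> (real^2^2) set"
    and g :: nat
    and f :: "nat \<Rightarrow> complex \<Rightarrow> complex"
    and z0 :: complex
  assumes "fuchsian_first_kind \<Gamma>"
    and "\<not> compact_space (modular_curve \<Gamma>)"
    and "has_genus (modular_curve \<Gamma>) g"
    and "cusp_representatives \<Gamma> C"
    and "scaling_matrices \<Gamma> C \<sigma>"
    and "is_basis {1..g} f (S2 \<Gamma> C \<sigma>)"
    and "z0 \<in> uhp"
  shows "is_basis {0..g}
           (\<lambda>i. if i = 0 then on_uhp (\<lambda>z. 1)
                else on_uhp (\<lambda>z. contour_integral (linepath z0 z) (f i)))
           (M0_second \<Gamma> C \<sigma>)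
         \<and> fun_space.dim (M0_second \<Gamma> C \<sigma>) = g + 1"
proof -
  interpret cusped_fuchsian \<Gamma> C \<sigma>
    using assms by unfold_locales
  let ?S = "S2 \<Gamma> C \<sigma>" and ?M = "M0_second \<Gamma> C \<sigma>"
  define \<Phi> where "\<Phi> = (\<lambda>i. if i = 0 then on_uhp (\<lambda>z. 1)
                else on_uhp (\<lambda>z. contour_integral (linepath z0 z) (f i)))"
  \<comment> \<open>The derivative of \<open>\<Phi> i\<close>; index 0 belongs to the constant
    function.\<close>
  define D where "D i = (if i = 0 then 0 else f i)" for i
  have f_indep: "inj_on f {1..g} \<and> fun_space.independent (f ` {1..g})"
    and f_span: "fun_space.span (f ` {1..g}) = ?S"
    using assms(6) by (auto simp: is_basis_def)
  have S_sub: "fun_space.subspace ?S" using fun_space.subspace_span f_span by metis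
  have fS: "f i \<in> ?S" if "i \<in> {1..g}" for i
    using fun_space.span_base[of "f i" "f ` {1..g}"] that f_span by blast
  have D_S: "D i \<in> ?S" if "i \<in> {0..g}" for i
    using fS[of i] that fun_space.subspace_0[OF S_sub] by (auto simp: D_def)
  have dPhi: "(\<Phi> i has_field_derivative D i z) (at z)" if "i \<in> {0..g}" "z \<in> uhp" for i z
  proof (cases "i = 0")
    case True
    have "((\<lambda>z. 1) has_field_derivative (0::complex)) (at z)" by simp
    then have "(on_uhp (\<lambda>z. 1) has_field_derivative 0) (at z)"
      by (rule has_field_derivative_transform_within_open[OF _ open_uhp that(2)]) (simp add: on_uhp_def)
    then show ?thesis using True by (simp add: \<Phi>_def D_def)
  next
    case False
    then have "f i holomorphic_on uhp" using fS[of i] that(1) by (auto simp: S2_def)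
    then show ?thesis
      using contour_integral_linepath_derivative[OF _ assms(7) that(2)] False by (simp add: \<Phi>_def D_def)
  qed
  have Phi_uhp: "\<Phi> i \<in> uhp_functions" for i
    by (simp add: \<Phi>_def uhp_functions_def on_uhp_def)
  have dsum: "((\<lambda>z. \<Sum>i\<in>{0..g}. u i * \<Phi> i z) has_field_derivative (\<Sum>i\<in>{0..g}. u i * D i z)) (at z)"
    if "z \<in> uhp" for u z
    using dPhi that by (intro DERIV_sum DERIV_cmult) auto
  have D_sum: "(\<Sum>i\<in>{0..g}. u i * D i z) = (\<Sum>i\<in>{1..g}. u i * f i z)" for u z
  proof -
    have "{0..g} = insert 0 {1..g}" by auto
    then show ?thesis by (auto simp: D_def intro!: sum.cong)
  qed
  have Phi0: "\<Phi> 0 z = 1" if "z \<in> uhp" for z using that by (simp add: \<Phi>_def on_uhp_def)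

  \<comment> \<open>Differentiating a relation among the \<open>\<Phi> i\<close> gives one among the
    \<open>f i\<close>, so all coefficients but that of the constant vanish; evaluation at
    \<open>z0\<close> then disposes of the last one.\<close>
  have indep: "inj_on \<Phi> {0..g} \<and> fun_space.independent (\<Phi> ` {0..g})"
    unfolding inj_independent_image_iff[OF finite_atLeastAtMost]
  proof (intro allI impI)
    fix u assume 0: "(\<Sum>i\<in>{0..g}. fscale (u i) (\<Phi> i)) = 0"
    have 0: "(\<Sum>i\<in>{0..g}. u i * \<Phi> i z) = 0" for z
      using fun_cong[OF 0, of z] by (simp only: sum_fscale_apply zero_fun_apply)
    have "(\<Sum>i\<in>{1..g}. fscale (u i) (f i)) z = 0" for z
    proof (cases "z \<in> uhp")
      case True
      have "((\<lambda>z. \<Sum>i\<in>{0..g}. u i * \<Phi> i z) has_field_derivative 0) (at z)" by (simp only: 0 DERIV_const)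
      from DERIV_unique[OF this dsum[OF True]] show ?thesis by (simp only: sum_fscale_apply D_sum)
    next
      case False
      then have "f i z = 0" if "i \<in> {1..g}" for i using fS[OF that] by (simp add: S2_def uhp_functions_def)
      then show ?thesis by (simp add: sum_fscale_apply)
    qed
    then have "(\<Sum>i\<in>{1..g}. fscale (u i) (f i)) = 0" by (simp add: fun_eq_iff)
    then have u: "\<forall>i\<in>{1..g}. u i = 0"
      using f_indep unfolding inj_independent_image_iff[OF finite_atLeastAtMost] by blast
    have "{0..g} = insert 0 {1..g}" by auto
    then have "(\<Sum>i\<in>{0..g}. u i * \<Phi> i z0) = u 0" using u Phi0[OF assms(7)] by simp
    then have "u 0 = 0" using 0 by simp
    with u show "\<forall>i\<in>{0..g}. u i = 0" by (auto simp: Suc_le_eq)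
  qed

  have deriv_comb: "on_uhp (deriv F) = E" if "E \<in> uhp_functions"
    "\<And>z. z \<in> uhp \<Longrightarrow> (F has_field_derivative E z) (at z)" for E F
    using that DERIV_imp_deriv[OF that(2)] by (auto simp: fun_eq_iff on_uhp_def uhp_functions_def)
  have S_uhp: "E \<in> uhp_functions" if "E \<in> ?S" for E using that by (simp add: S2_def)
  have M_I: "F \<in> ?M" if F: "F \<in> uhp_functions" and E: "E \<in> ?S"
    and dF: "\<And>z. z \<in> uhp \<Longrightarrow> (F has_field_derivative E z) (at z)" for E F
  proof -
    have "F holomorphic_on uhp"
      using dF by (meson field_differentiable_at_within field_differentiable_def holomorphic_onI)
    then show ?thesis using deriv_comb[OF S_uhp[OF E] dF] F E by (simp add: M0_second_iff)
  qed
  have "fun_space.span (\<Phi> ` {0..g}) = ?M"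
  proof
    show "fun_space.span (\<Phi> ` {0..g}) \<subseteq> ?M"
    proof
      fix F assume "F \<in> fun_space.span (\<Phi> ` {0..g})"
      then obtain v where "F = (\<Sum>x\<in>\<Phi> ` {0..g}. fscale (v x) x)"
        using fun_space.span_finite[of "\<Phi> ` {0..g}"] by auto
      then have F: "F = (\<Sum>i\<in>{0..g}. fscale (v (\<Phi> i)) (\<Phi> i))" using indep by (simp add: sum.reindex)
      show "F \<in> ?M"
      proof (rule M_I)
        show "F \<in> uhp_functions" using Phi_uhp by (simp add: F uhp_functions_def sum_fscale_apply)
        show "(\<Sum>i\<in>{0..g}. fscale (v (\<Phi> i)) (D i)) \<in> ?S"
          using D_S S_sub by (intro fun_space.subspace_sum fun_space.subspace_scale) auto
        show "(F has_field_derivative (\<Sum>i\<in>{0..g}. fscale (v (\<Phi> i)) (D i)) z) (at z)" if "z \<in> uhp" for z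
          using dsum[OF that, of "\<lambda>i. v (\<Phi> i)"] unfolding F sum_fscale_apply[abs_def] .
      qed
    qed
    show "?M \<subseteq> fun_space.span (\<Phi> ` {0..g})"
    proof
      fix F assume "F \<in> ?M"
      then have F: "F \<in> uhp_functions" "F holomorphic_on uhp" "on_uhp (deriv F) \<in> ?S"
        by (auto simp: M0_second_iff)
      then obtain v where "on_uhp (deriv F) = (\<Sum>x\<in>f ` {1..g}. fscale (v x) x)"
        using fun_space.span_finite[of "f ` {1..g}"] f_span by auto
      then have dF: "on_uhp (deriv F) = (\<Sum>i\<in>{1..g}. fscale (v (f i)) (f i))"
        using f_indep by (simp add: sum.reindex)
      \<comment> \<open>At index 0 the value \<open>v (f 0)\<close> is arbitrary. It does no harm:
        \<open>D 0\<close> is 0, so the derivative does not see it, and the constant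
        \<open>c\<close> found below corrects the coefficient of \<open>\<Phi> 0\<close>.\<close>
      define u where "u i = v (f i)" for i
      define R where "R = (\<lambda>z. F z - (\<Sum>i\<in>{0..g}. u i * \<Phi> i z))"
      have "(R has_field_derivative 0) (at z)" if z: "z \<in> uhp" for z
      proof -
        have "deriv F z = (\<Sum>i\<in>{0..g}. u i * D i z)"
          using fun_cong[OF dF, of z] z unfolding D_sum sum_fscale_apply u_def by (simp add: on_uhp_def)
        then show ?thesis
          using DERIV_diff[OF holomorphic_derivI[OF F(2) open_uhp z] dsum[OF z, of u]] by (simp add: R_def)
      qed
      then obtain c where c: "\<And>z. z \<in> uhp \<Longrightarrow> R z = c"
        using uhp_constant_if_derivative_zero[of R] by metis
      have "F = (\<Sum>i\<in>{0..g}. fscale (u i) (\<Phi> i)) + fscale c (\<Phi> 0)"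
      proof
        fix z
        show "F z = ((\<Sum>i\<in>{0..g}. fscale (u i) (\<Phi> i)) + fscale c (\<Phi> 0)) z"
        proof (cases "z \<in> uhp")
          case True
          then show ?thesis
            using c[OF True] Phi0[OF True] by (simp add: R_def sum_fscale_apply) (simp add: fscale_def algebra_simps)
        next
          case False
          then show ?thesis using F(1) Phi_uhp by (simp add: sum_fscale_apply uhp_functions_def) (simp add: fscale_def)
        qed
      qed
      moreover have "\<Phi> i \<in> fun_space.span (\<Phi> ` {0..g})" if "i \<in> {0..g}" for i
        using that by (intro fun_space.span_base imageI)
      ultimately show "F \<in> fun_space.span (\<Phi> ` {0..g})"
        by (auto intro!: fun_space.span_add fun_space.span_sum fun_space.span_scale)
    qed
  qed
  moreover from this have "fun_space.dim ?M = card (\<Phi> ` {0..g})"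
    using fun_space.dim_span_eq_card_independent indep by metis
  ultimately show ?thesis
    using indep unfolding is_basis_def \<Phi>_def[symmetric] by (simp add: card_image)
qed

end
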